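(* Let $A=(B,O,S)$ be an abduction instance, let $P_{\mathrm{BwdA}}(A)$ be the ASP program defined in the context, and let $P_{\mathrm{CARD}}$, $P_{\mathrm{COH}}$, $P_{\mathrm{WA}}$ be the following programs. $P_{\mathrm{CARD}}$: $$:\sim abduce(P).\ [1@1,P]$$ $P_{\mathrm{COH}}$: $$reach(P,P)\leftarrow goal(P).$$ $$reach(Q,From)\leftarrow reach(P,From),inferVia(R,P),inferenceNeeds(P,R,Q).$$ $$reach(Q,From)\leftarrow reach(P,From),factorVia(P,Q).$$ $$reachFromBoth(P,Q)\leftarrow goal(P),goal(Q),P<Q,reach(N,P),reach(N,Q).$$ $$:\sim goal(P),goal(Q),P<Q,\mathrm{not}\ reachFromBoth(P,Q).\ [1@1,P,Q]$$ $P_{\mathrm{WA}}$: $$pcost(P,100)\leftarrow goal(P).$$ $$pcost(Q,Mc)\leftarrow inferVia(R,P),inferenceNeeds(P,R,Q),Mc=\#max\{(C*6/5)/N\,;\,1\},pcost(P,C),numberOfBodies(R,N).$$ $$pcost(Q,C)\leftarrow factorVia(P,Q),pcost(P,C).$$ $$cost(P,C)\leftarrow abduce(P),C=\#min\{Ic: pcost(P,Ic)\}.$$ $$:\sim cost(P,C).\ [C@1,P]$$ Then the cost of an answer set $I$ of $P_{\mathrm{BwdA}}(A)\cup P_{\mathrm{CARD}}$, of $P_{\mathrm{BwdA}}(A)\cup P_{\mathrm{COH}}$, and of $P_{\mathrm{BwdA}}(A)\cup P_{\mathrm{WA}}$ is the objective function value $\mathrm{CARD}(G)$, $\mathrm{COH}(G)$,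 and $\mathrm{WA}(G)$, respectively, of the proof graph $G$ represented in $I$, where for $\mathrm{WA}$ costs are rounded to integers and at least $1$.
   Context: **Abduction instances.** An abduction instance is a tuple $A=(B,O,S)$. Here $O$ (observation, goal) is an existentially quantified conjunction of atoms $\exists V_1,\dots,V_k: o_1(V_1,\dots,V_k)\wedge\cdots\wedge o_m(V_1,\dots,V_k)$, also regarded as a set of atoms, in which each existential variable $V_i$ is represented by a constant $v_i\notin S$. $B$ is a finite set of axioms, each a single-head Horn clause $$q(Y_1,\dots,Y_m)\Leftarrow p_1(X^1_1,\dots,X^1_{k_1})\wedge\cdots\wedge p_r(X^r_1,\dots,X^r_{k_r}),$$ with body variables $\mathcal X$, head variables $\mathcal Y\subseteq\mathcal X$, universally quantified over $\mathcal X$ (constants may also occur as arguments; they are left unchanged by the rewriting, and only head variables are arguments of Skolem terms). $S$ is a set of constants of $B$ called sort names. $B$ is assumed acyclic (no circular inferences are possible over the axioms), and all atoms in $B$ and $O$ are assumed to have arity 2. **Hypotheses.** A hypothesis is a conjunction of atoms and equalities between terms. The set $\hat{\mathcal H}(A)$ of all hypotheses of $A$ is obtained from $\{O\}$ by closing under two operations. *Back-chaining*: given an atom $P$ in a hypothesis $H$ that unifies via $\theta$ with the head of an axiom, add the hypothesis $H\wedge P_1'\wedge\cdots\wedge P_r'$ with $P_i'=\theta(p_i(X^i_1,\dots,X^i_{k_i}))$, where body variables not in the head are existential and are replaced by Skolem terms (value invention). *Unification*: given distinct atoms $P,Q\in H$ unifying under $\theta$ such that all $X\mapsto Y\in\theta$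 obey $X,Y\notin S$, add $H\wedge\bigwedge\{X=Y\mid X\mapsto Y\in\theta\}$. **Proof graphs.** A proof graph $G$ wrt. $H\in\hat{\mathcal H}(A)$ is an acyclic directed graph with nodes $N(G)=\{P\in H\mid P\text{ is not an equality}\}$ and edges $E(G)$ defined by the inference operations used to generate the atoms of $H$: back-chaining of $P$ induces an edge from each body atom $P_i'$ to $P$; unification of $P$ with $Q$ induces either an edge from $P$ to $Q$ or an edge from $Q$ to $P$. A unification edge $(P,Q)$ from $P$ to $Q$ is called a factoring edge, and $Q$ is said to be factored with $P$. Only hypotheses and proof graphs are considered where each atom is justified by a single inference (back-chaining), or by a single factoring, or not at all (then it is abduced). Let $A(G)=\{a\in N(G)\mid\nexists b:(b,a)\in E(G)\}$. **Objective functions.** - $\mathrm{CARD}(G)=|A(G)|$. - $\mathrm{COH}(G)=|\{(a,b)\mid a,b\in O,\ a<b,\text{ and }\nexists n\in N(G)\text{ such that from }n\text{ we can reach both }a\text{ and }b\text{ in }G\}|$, where $<$ is an arbitrary fixed total order on $O$ (e.g., lexicographic). - $\mathrm{WA}(G)=\sum_{a\in A(G)}\min cost(a)$, where each axiom has weights $w_1,\dots,w_r$ for its body atoms, each $o\in O$ has an initial cost $ic(o)$, and $cost:N(G)\to2^{\mathbb R}$ is initialized with $\emptyset$ and recursively defined: (i) each $o\in O$ obtains $ic(o)$ as an element of $cost(o)$; (ii) if $P$ was back-chained with an axiom with body atoms $P_1',\dots,P_r'$ and $c=\min cost(P)$, then $c\cdot w_i$ is added to $cost(P_i')$ for $1\le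 i\le r$; (iii) if there is a factoring edge $(Q,P)$ from $Q$ to $P$, then $\min cost(P)$ is added to $cost(Q)$. Here $ic(o)=100$ for all $o\in O$, and $w_i=1.2/r$ for an axiom with $r$ body atoms. The rounding to integers and lower bound $1$ take place at each back-chaining step as in the second rule of $P_{\mathrm{WA}}$ (ASP integer arithmetic). **ASP program $P_{\mathrm{BwdA}}(A)=P_{bpt}(A)\cup P_{gp}\cup P_{eq}\cup P_c$.** An atom $p(a,b)$ is represented by the term $c(p,a,b)$. $P_{bpt}(A)$ consists of: the fact $goal(c(o_i,v_1,\dots,v_k))$ for each atom of $O$; the fact $sortname(s)$ for each $s\in S$; for each axiom with unique identifier $a$ and $\{Z_1,\dots,Z_v\}=\mathcal X\setminus\mathcal Y$ the rules $$mayInferVia(a,c(q,Y_1,\dots,Y_m),l(Z_1,\dots,Z_v))\leftarrow pot(c(q,Y_1,\dots,Y_m)),\ Z_1=s(a,1,Y_1,\dots,Y_m),\dots,Z_v=s(a,v,Y_1,\dots,Y_m).$$ $$inferenceNeeds(c(q,Y_1,\dots,Y_m),a,c(p_i,X^i_1,\dots,X^i_{k_i}))\leftarrow mayInferVia(a,c(q,Y_1,\dots,Y_m),l(Z_1,\dots,Z_v)).\quad (1\le i\le r)$$ and the rules $pot(X)\leftarrow goal(X).$ and $pot(P)\leftarrow inferenceNeeds(\_,\_,P).$ For $\mathrm{WA}$, a fact $numberOfBodies(a,r)$ is also required for each axiom with identifier $a$ and $r$ body atoms. $P_{gp}$ consists of $$true(P)\leftarrow goal(P).\qquad 1\le\{infer(P);fai(P)\}\le1\leftarrow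 true(P).$$ $$1\le\{inferVia(R,P): mayInferVia(R,P,\_)\}\le1\leftarrow infer(P).$$ $$true(Q)\leftarrow inferVia(R,P),\ inferenceNeeds(P,R,Q).$$ $P_{eq}$ consists of $$hu(X)\leftarrow pot(c(\_,X,\_)).\qquad hu(X)\leftarrow pot(c(\_,\_,X)).\qquad uhu(X)\leftarrow hu(X),\mathrm{not}\ sortname(X).$$ $$\{eq(A,B): uhu(A),uhu(B),A\neq B\}\leftarrow.\qquad eq(A,A)\leftarrow hu(A).$$ $$\leftarrow eq(A,B),\mathrm{not}\ eq(B,A).\qquad \leftarrow eq(A,B),eq(B,C),A\neq B,B\neq C,A\neq C,\mathrm{not}\ eq(A,C).$$ $P_c$ consists of $$factorCluster(c(P,S_2,O_2),c(P,S_1,O_1))\leftarrow fa(c(P,S_1,O_1)),fa(c(P,S_2,O_2)),eq(S_1,S_2),c(P,S_1,O_1)<c(P,S_2,O_2),eq(O_1,O_2).$$ $$factorClusterAbove(A)\leftarrow factorCluster(A,\_).$$ $$factorVia(A,B)\leftarrow factorCluster(A,B),\mathrm{not}\ factorClusterAbove(B).$$ $$factor(P)\leftarrow factorVia(P,\_).\qquad abduce(P)\leftarrow fa(P),\mathrm{not}\ factor(P).\qquad fa(P)\leftarrow fai(P).$$ Answer sets are those of standard ASP-Core-2 semantics (choice heads, aggregates $\#min$, $\#max$); $<$ on terms is the (lexicographic) total order on ground terms; $\_$ is an anonymous variable. A weak constraint $:\sim body.\ [w@1,t_1,\dots,t_k]$ contributes cost $w$ to an answer set $I$ for each distinct tuple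 $t_1,\dots,t_k$ of its ground instances whose body is satisfied by $I$; the cost of $I$ is the total of these. The proof graph $G$ represented in $I$ has nodes $\{P\mid true(P)\in I\}$, back-chaining edges $(Q,P)$ with $inferVia(R,P),inferenceNeeds(P,R,Q)\in I$, and factoring edges $(Q,P)$ with $factorVia(P,Q)\in I$. *)

theory Defs
  imports Complex_Main
begin

section \<open>Ground answer set programs\<close>

type_synonym name = String.literal

text \<open>Ground terms. A symbolic constant is a function symbol without arguments.\<close>

datatype gterm = Num int | Fn name "gterm list"

abbreviation Sym :: "name \<Rightarrow> gterm" where
  "Sym f \<equiv> Fn f []"

text \<open>The total order on ground terms of ASP-Core-2: integers before symbolic constants before
  compound terms; compound terms by arity, then by functor, then by arguments.\<close>

fun tless :: "gterm \<Rightarrow> gterm \<Rightarrow> bool" and tless_args :: "gterm list \<Rightarrow> gterm list \<Rightarrow> bool" where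
  "tless (Num i) (Num j) = (i < j)"
| "tless (Num i) (Fn g us) = True"
| "tless (Fn f ts) (Num j) = False"
| "tless (Fn f ts) (Fn g us) =
     (length ts < length us \<or>
      length ts = length us \<and> (f < g \<or> f = g \<and> tless_args ts us))"
| "tless_args (t # ts) (u # us) = (tless t u \<or> t = u \<and> tless_args ts us)"
| "tless_args _ _ = False"

definition tle :: "gterm \<Rightarrow> gterm \<Rightarrow> bool" where
  "tle t u \<longleftrightarrow> tless t u \<or> t = u"

text \<open>A program is the set of its ground instances: global variables are instantiated by set
  comprehension over all ground terms, local variables of choice and aggregate elements by
  comprehension inside the element set. Arithmetic terms are evaluated, and a built-in comparison
  is represented by its truth value.\<close>

datatype 'a lit = Pos 'a | Neg 'a | Cmp bool

datatype 'a blit =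
    Lit "'a lit"
  | MinEq gterm "(gterm \<times> 'a lit list) set"  \<comment> \<open>\<open>t = #min {u : ls; \<dots>}\<close>\<close>
  | MaxEq gterm "(gterm \<times> 'a lit list) set"

abbreviation pos :: "'a \<Rightarrow> 'a blit" where "pos a \<equiv> Lit (Pos a)"
abbreviation naf :: "'a \<Rightarrow> 'a blit" where "naf a \<equiv> Lit (Neg a)"
abbreviation cmp :: "bool \<Rightarrow> 'a blit" where "cmp b \<equiv> Lit (Cmp b)"

datatype 'a head =
    Head 'a
  | Choice "nat option" "('a \<times> 'a lit list) set" "nat option"  \<comment> \<open>optional lower and upper bound\<close>
  | Bot

datatype 'a stmt =
    Rule "'a head" "'a blit list"
  | Weak "'a blit list" int nat "gterm list"  \<comment> \<open>\<open>:~ body. [w@l, ts]\<close>\<close>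

abbreviation fact :: "'a \<Rightarrow> 'a stmt" where "fact a \<equiv> Rule (Head a) []"
abbreviation rule :: "'a \<Rightarrow> 'a blit list \<Rightarrow> 'a stmt" where "rule a b \<equiv> Rule (Head a) b"

type_synonym 'a program = "'a stmt set"

fun lit_sat :: "'a set \<Rightarrow> 'a lit \<Rightarrow> bool" where
  "lit_sat I (Pos a) = (a \<in> I)"
| "lit_sat I (Neg a) = (a \<notin> I)"
| "lit_sat I (Cmp b) = b"

definition lits_sat :: "'a set \<Rightarrow> 'a lit list \<Rightarrow> bool" where
  "lits_sat I ls \<longleftrightarrow> (\<forall>l\<in>set ls. lit_sat I l)"

definition agg_terms :: "'a set \<Rightarrow> (gterm \<times> 'a lit list) set \<Rightarrow> gterm set" where
  "agg_terms I es = {t. \<exists>ls. (t, ls) \<in> es \<and> lits_sat I ls}"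

text \<open>The minimum and maximum of the empty set are infinite in ASP-Core-2, hence equal to no
  ground term.\<close>

fun blit_sat :: "'a set \<Rightarrow> 'a blit \<Rightarrow> bool" where
  "blit_sat I (Lit l) = lit_sat I l"
| "blit_sat I (MinEq t es) = (t \<in> agg_terms I es \<and> (\<forall>u\<in>agg_terms I es. tle t u))"
| "blit_sat I (MaxEq t es) = (t \<in> agg_terms I es \<and> (\<forall>u\<in>agg_terms I es. tle u t))"

definition body_sat :: "'a set \<Rightarrow> 'a blit list \<Rightarrow> bool" where
  "body_sat I b \<longleftrightarrow> (\<forall>l\<in>set b. blit_sat I l)"

definition chosen :: "'a set \<Rightarrow> ('a \<times> 'a lit list) set \<Rightarrow> 'a set" where
  "chosen I es = {a \<in> I. \<exists>ls. (a, ls) \<in> es \<and> lits_sat I ls}"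

fun head_sat :: "'a set \<Rightarrow> 'a head \<Rightarrow> bool" where
  "head_sat I (Head a) = (a \<in> I)"
| "head_sat I (Choice lo es up) =
     ((\<forall>n. lo = Some n \<longrightarrow> infinite (chosen I es) \<or> n \<le> card (chosen I es)) \<and>
      (\<forall>n. up = Some n \<longrightarrow> finite (chosen I es) \<and> card (chosen I es) \<le> n))"
| "head_sat I Bot = False"

definition is_model :: "'a program \<Rightarrow> 'a set \<Rightarrow> bool" where
  "is_model P I \<longleftrightarrow> (\<forall>h b. Rule h b \<in> P \<longrightarrow> body_sat I b \<longrightarrow> head_sat I h)"

text \<open>Satisfaction of the reduct with respect to \<open>I\<close> by a subset \<open>J\<close> of \<open>I\<close>. The reduct keeps the
  rules whose body holds in \<open>I\<close> (Faber, Leone, Pfeifer). ASP-Core-2 reads a choice element \<open>a : ls\<close>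
  under a body \<open>b\<close> as the disjunctive rule with head \<open>a\<close> or a fresh complement of \<open>a\<close> and with
  body \<open>b, ls\<close>; below \<open>I\<close>, this requires \<open>a\<close> exactly if \<open>a\<close> is in \<open>I\<close>.\<close>

fun reduct_head_sat :: "'a set \<Rightarrow> 'a set \<Rightarrow> 'a head \<Rightarrow> bool" where
  "reduct_head_sat I J (Head a) = (a \<in> J)"
| "reduct_head_sat I J (Choice lo es up) =
     (\<forall>a ls. (a, ls) \<in> es \<longrightarrow> a \<in> I \<longrightarrow> lits_sat I ls \<longrightarrow> lits_sat J ls \<longrightarrow> a \<in> J)"
| "reduct_head_sat I J Bot = False"

definition reduct_model :: "'a program \<Rightarrow> 'a set \<Rightarrow> 'a set \<Rightarrow> bool" where
  "reduct_model P I J \<longleftrightarrow>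
     (\<forall>h b. Rule h b \<in> P \<longrightarrow> body_sat I b \<longrightarrow> body_sat J b \<longrightarrow> reduct_head_sat I J h)"

definition answer_set :: "'a program \<Rightarrow> 'a set \<Rightarrow> bool" where
  "answer_set P I \<longleftrightarrow> is_model P I \<and> (\<forall>J. J \<subset> I \<longrightarrow> \<not> reduct_model P I J)"

definition answer_cost :: "'a program \<Rightarrow> 'a set \<Rightarrow> int" where
  "answer_cost P I =
     (\<Sum>(w, l, ts) \<in> {(w, l, ts). \<exists>b. Weak b w l ts \<in> P \<and> body_sat I b}. w)"

text \<open>Integer division of ASP truncates towards zero.\<close>

definition asp_div :: "int \<Rightarrow> int \<Rightarrow> int" where
  "asp_div x y = sgn x * sgn y * (\<bar>x\<bar> div \<bar>y\<bar>)"


section \<open>Abduction instances\<close>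

datatype arg = Var name | Con name

datatype atom = Atom name arg arg

record axiom =
  ident :: name
  hatom :: atom
  batoms :: "atom list"

fun arg_vars :: "arg \<Rightarrow> name list" where
  "arg_vars (Var v) = [v]"
| "arg_vars (Con k) = []"

fun atom_vars :: "atom \<Rightarrow> name list" where
  "atom_vars (Atom p x y) = arg_vars x @ arg_vars y"

fun atom_consts :: "atom \<Rightarrow> name set" where
  "atom_consts (Atom p x y) = {k. x = Con k \<or> y = Con k}"

definition axiom_consts :: "axiom \<Rightarrow> name set" where
  "axiom_consts a = atom_consts (hatom a) \<union> (\<Union>b\<in>set (batoms a). atom_consts b)"

definition head_vars :: "axiom \<Rightarrow> name list" where
  "head_vars a = atom_vars (hatom a)"

definition body_vars :: "axiom \<Rightarrow> name list" where
  "body_vars a = concat (map atom_vars (batoms a))"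

text \<open>The enumeration of the body variables that do not occur in the head.\<close>

definition inv_vars :: "axiom \<Rightarrow> name list" where
  "inv_vars a = remdups (filter (\<lambda>v. v \<notin> set (head_vars a)) (body_vars a))"

text \<open>The ground atom \<open>p(x, y)\<close> of a hypothesis is identified with the term \<open>c(p, x, y)\<close>.\<close>

abbreviation c_term :: "gterm \<Rightarrow> gterm \<Rightarrow> gterm \<Rightarrow> gterm" where
  "c_term p x y \<equiv> Fn (STR ''c'') [p, x, y]"

abbreviation l_term :: "gterm list \<Rightarrow> gterm" where
  "l_term zs \<equiv> Fn (STR ''l'') zs"

abbreviation s_term :: "name \<Rightarrow> nat \<Rightarrow> gterm list \<Rightarrow> gterm" where
  "s_term a i ys \<equiv> Fn (STR ''s'') (Sym a # Num (int i) # ys)"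

fun inst_arg :: "(name \<Rightarrow> gterm) \<Rightarrow> arg \<Rightarrow> gterm" where
  "inst_arg \<sigma> (Var v) = \<sigma> v"
| "inst_arg \<sigma> (Con k) = Sym k"

fun inst :: "(name \<Rightarrow> gterm) \<Rightarrow> atom \<Rightarrow> gterm" where
  "inst \<sigma> (Atom p x y) = c_term (Sym p) (inst_arg \<sigma> x) (inst_arg \<sigma> y)"

text \<open>Back-chaining of \<open>P\<close> with the axiom \<open>a\<close> yields the body atoms \<open>Qs\<close>.\<close>

definition back_chain :: "axiom \<Rightarrow> gterm \<Rightarrow> gterm list \<Rightarrow> bool" where
  "back_chain a P Qs \<longleftrightarrow>
     (\<exists>\<sigma>. P = inst \<sigma> (hatom a) \<and>
          (\<forall>i < length (inv_vars a).
             \<sigma> (inv_vars a ! i) = s_term (ident a) (Suc i) (map \<sigma> (head_vars a))) \<and>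
          Qs = map (inst \<sigma>) (batoms a))"

text \<open>No infinite chain of back-chaining steps starts at any ground atom. As finitely many axioms
  are given, such a chain would use some axiom again and again. The condition follows from
  acyclicity of the dependency graph between axioms or between predicates, but it does not reject
  an axiom like \<open>inst(X, person) \<Leftarrow> inst(X, male)\<close>.\<close>

definition acyclic_axioms :: "axiom set \<Rightarrow> bool" where
  "acyclic_axioms B \<longleftrightarrow> wf {(Q, P). \<exists>a\<in>B. \<exists>Qs. back_chain a P Qs \<and> Q \<in> set Qs}"

text \<open>The variables of \<open>obs\<close> are the existential variables of the observation; \<open>evar\<close> maps each of
  them to the constant that represents it.\<close>

record abduction =
  axioms :: "axiom set"
  obs :: "atom set"
  evar :: "name \<Rightarrow> name"
  sorts :: "name set"

definition obs_vars :: "abduction \<Rightarrow> name set" where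
  "obs_vars A = (\<Union>p\<in>obs A. set (atom_vars p))"

definition goals :: "abduction \<Rightarrow> gterm set" where
  "goals A = inst (\<lambda>v. Sym (evar A v)) ` obs A"

definition abduction_instance :: "abduction \<Rightarrow> bool" where
  "abduction_instance A \<longleftrightarrow>
     finite (axioms A) \<and>
     inj_on ident (axioms A) \<and>
     (\<forall>a\<in>axioms A. batoms a \<noteq> [] \<and> set (head_vars a) \<subseteq> set (body_vars a)) \<and>
     acyclic_axioms (axioms A) \<and>
     finite (obs A) \<and>
     inj_on (evar A) (obs_vars A) \<and>
     evar A ` obs_vars A \<inter> sorts A = {} \<and>
     sorts A \<subseteq> (\<Union>a\<in>axioms A. axiom_consts a)"


section \<open>Hypotheses and proof graphs\<close>

text \<open>A back-chaining edge \<open>(Q, a, P)\<close> from \<open>Q\<close> to \<open>P\<close> carries the identifier \<open>a\<close> of its axiom.\<close>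

record pgraph =
  nodes :: "gterm set"
  bc_edges :: "(gterm \<times> gterm \<times> gterm) set"
  fac_edges :: "(gterm \<times> gterm) set"

definition edges :: "pgraph \<Rightarrow> (gterm \<times> gterm) set" where
  "edges G = {(Q, P). \<exists>a. (Q, a, P) \<in> bc_edges G} \<union> fac_edges G"

text \<open>\<open>generates A N E Bc F\<close>: the hypothesis with atoms \<open>N\<close> and equalities \<open>E\<close> is obtained from the
  observation by operations that induce the back-chaining edges \<open>Bc\<close> and the factoring edges \<open>F\<close>.
  In \<open>unify\<close>, constants and Skolem terms other than sort names play the role of variables; the
  unifier \<open>\<theta>\<close> is recorded by the equations between the arguments that differ. The roles of \<open>P\<close> and \<open>Q\<close> are interchangeable, so the edge may have either direction.\<close>

inductive generates ::
  "abduction \<Rightarrow> gterm set \<Rightarrow> (gterm \<times> gterm) set \<Rightarrow>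
   (gterm \<times> gterm \<times> gterm) set \<Rightarrow> (gterm \<times> gterm) set \<Rightarrow> bool"
  for A :: abduction where
  start: "generates A (goals A) {} {} {}"
| chain: "generates A N E Bc F \<Longrightarrow> P \<in> N \<Longrightarrow> a \<in> axioms A \<Longrightarrow> back_chain a P Qs \<Longrightarrow>
    generates A (N \<union> set Qs) E (Bc \<union> {(Q, Sym (ident a), P) | Q. Q \<in> set Qs}) F"
| unify: "generates A N E Bc F \<Longrightarrow> P \<in> N \<Longrightarrow> Q \<in> N \<Longrightarrow> P \<noteq> Q \<Longrightarrow>
    P = c_term p x y \<Longrightarrow> Q = c_term p x' y' \<Longrightarrow> \<theta> = {(x, x'), (y, y')} - Id \<Longrightarrow>
    (\<forall>(X, Y)\<in>\<theta>. X \<notin> Sym ` sorts A \<and> Y \<notin> Sym ` sorts A) \<Longrightarrow>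
    generates A N (E \<union> \<theta>) Bc (insert (P, Q) F)"

definition hypotheses :: "abduction \<Rightarrow> (gterm set \<times> (gterm \<times> gterm) set) set" where
  "hypotheses A = {(N, E). \<exists>Bc F. generates A N E Bc F}"

text \<open>Every atom is back-chained with at most one axiom, or factored with exactly one atom, or
  abduced.\<close>

definition single_justification :: "pgraph \<Rightarrow> bool" where
  "single_justification G \<longleftrightarrow>
     (\<forall>P Q Q' a a'. (Q, a, P) \<in> bc_edges G \<longrightarrow> (Q', a', P) \<in> bc_edges G \<longrightarrow> a = a') \<and>
     (\<forall>P Q Q'. (Q, P) \<in> fac_edges G \<longrightarrow> (Q', P) \<in> fac_edges G \<longrightarrow> Q = Q') \<and>
     (\<forall>P Q Q' a. \<not> ((Q, a, P) \<in> bc_edges G \<and> (Q', P) \<in> fac_edges G))"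

definition proof_graph :: "abduction \<Rightarrow> gterm set \<times> (gterm \<times> gterm) set \<Rightarrow> pgraph \<Rightarrow> bool" where
  "proof_graph A H G \<longleftrightarrow>
     nodes G = fst H \<and>
     generates A (fst H) (snd H) (bc_edges G) (fac_edges G) \<and>
     acyclic (edges G) \<and>
     single_justification G"


section \<open>Objective functions\<close>

definition abduced :: "pgraph \<Rightarrow> gterm set" where
  "abduced G = {a \<in> nodes G. \<nexists>b. (b, a) \<in> edges G}"

definition CARD_obj :: "pgraph \<Rightarrow> nat" where
  "CARD_obj G = card (abduced G)"

definition COH_obj :: "abduction \<Rightarrow> (gterm \<times> gterm) set \<Rightarrow> pgraph \<Rightarrow> nat" where
  "COH_obj A lt G =
     card {(a, b). a \<in> goals A \<and> b \<in> goals A \<and> (a, b) \<in> lt \<and>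
                   (\<nexists>n. n \<in> nodes G \<and> (n, a) \<in> (edges G)\<^sup>* \<and> (n, b) \<in> (edges G)\<^sup>*)}"

text \<open>The defining equation of the cost function, for initial costs \<open>ic\<close>, weights \<open>w a i\<close> of the body
  atoms (counted from 0), and a function \<open>rnd\<close> that is applied at each back-chaining step. Taking the
  minimum is not monotone, but on a finite acyclic graph the equation has a unique solution.\<close>

definition is_wa_cost ::
  "abduction \<Rightarrow> (gterm \<Rightarrow> real) \<Rightarrow> (axiom \<Rightarrow> nat \<Rightarrow> real) \<Rightarrow> (real \<Rightarrow> real) \<Rightarrow>
   pgraph \<Rightarrow> (gterm \<Rightarrow> real set) \<Rightarrow> bool" where
  "is_wa_cost A ic w rnd G f \<longleftrightarrow>
     (\<forall>Q. f Q =
        (if Q \<in> nodes G then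
           (if Q \<in> goals A then {ic Q} else {}) \<union>
           {rnd (Min (f P) * w a i) | P a Qs i.
              P \<in> nodes G \<and> f P \<noteq> {} \<and> a \<in> axioms A \<and> back_chain a P Qs \<and>
              i < length Qs \<and> Q = Qs ! i \<and> (Q, Sym (ident a), P) \<in> bc_edges G} \<union>
           {Min (f P) | P. P \<in> nodes G \<and> f P \<noteq> {} \<and> (Q, P) \<in> fac_edges G}
         else {}))"

definition wa_cost ::
  "abduction \<Rightarrow> (gterm \<Rightarrow> real) \<Rightarrow> (axiom \<Rightarrow> nat \<Rightarrow> real) \<Rightarrow> (real \<Rightarrow> real) \<Rightarrow>
   pgraph \<Rightarrow> gterm \<Rightarrow> real set" where
  "wa_cost A ic w rnd G = (THE f. is_wa_cost A ic w rnd G f)"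

definition WA_obj ::
  "abduction \<Rightarrow> (gterm \<Rightarrow> real) \<Rightarrow> (axiom \<Rightarrow> nat \<Rightarrow> real) \<Rightarrow> (real \<Rightarrow> real) \<Rightarrow> pgraph \<Rightarrow> real" where
  "WA_obj A ic w rnd G = (\<Sum>a\<in>abduced G. Min (wa_cost A ic w rnd G a))"

definition ic100 :: "gterm \<Rightarrow> real" where
  "ic100 P = 100"

definition uniform_weight :: "axiom \<Rightarrow> nat \<Rightarrow> real" where
  "uniform_weight a i = 1.2 / real (length (batoms a))"

text \<open>For a positive integer \<open>c\<close>, the value \<open>round_cost (c * 1.2 / n)\<close> is the maximum of 1 and the
  result of \<open>(c * 6 / 5) / n\<close> in integer arithmetic.\<close>

definition round_cost :: "real \<Rightarrow> real" where
  "round_cost x = max (of_int \<lfloor>x\<rfloor>) 1"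


section \<open>The encoding\<close>

datatype patom =
    goal gterm
  | sortname gterm
  | mayInferVia gterm gterm gterm
  | inferenceNeeds gterm gterm gterm
  | numberOfBodies gterm gterm
  | pot gterm
  | true gterm
  | infer gterm
  | fai gterm
  | inferVia gterm gterm
  | hu gterm
  | uhu gterm
  | eq gterm gterm
  | fa gterm
  | factorCluster gterm gterm
  | factorClusterAbove gterm
  | factorVia gterm gterm
  | factor gterm
  | abduce gterm
  | reach gterm gterm
  | reachFromBoth gterm gterm
  | pcost gterm gterm
  | cost gterm gterm

definition P_bpt :: "abduction \<Rightarrow> patom program" where
  "P_bpt A =
     {fact (goal P) | P. P \<in> goals A} \<union>
     {fact (sortname (Sym s)) | s. s \<in> sorts A} \<union>
     {rule (mayInferVia (Sym (ident a)) (inst \<sigma> (hatom a)) (l_term (map \<sigma> (inv_vars a))))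
        (pos (pot (inst \<sigma> (hatom a))) #
         map (\<lambda>i. cmp (\<sigma> (inv_vars a ! i) = s_term (ident a) (Suc i) (map \<sigma> (head_vars a))))
           [0..<length (inv_vars a)])
      | a \<sigma>. a \<in> axioms A} \<union>
     {rule (inferenceNeeds (inst \<sigma> (hatom a)) (Sym (ident a)) (inst \<sigma> (batoms a ! i)))
        [pos (mayInferVia (Sym (ident a)) (inst \<sigma> (hatom a)) (l_term (map \<sigma> (inv_vars a))))]
      | a \<sigma> i. a \<in> axioms A \<and> i < length (batoms a)} \<union>
     {rule (pot X) [pos (goal X)] | X. True} \<union>
     {rule (pot P) [pos (inferenceNeeds X Y P)] | P X Y. True}"

definition P_gp :: "patom program" where
  "P_gp =
     {rule (true P) [pos (goal P)] | P. True} \<union>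
     {Rule (Choice (Some 1) {(infer P, []), (fai P, [])} (Some 1)) [pos (true P)] | P. True} \<union>
     {Rule (Choice (Some 1) {(inferVia R P, [Pos (mayInferVia R P L)]) | R L. True} (Some 1))
        [pos (infer P)] | P. True} \<union>
     {rule (true Q) [pos (inferVia R P), pos (inferenceNeeds P R Q)] | P Q R. True}"

definition P_eq :: "patom program" where
  "P_eq =
     {rule (hu X) [pos (pot (c_term U X V))] | U X V. True} \<union>
     {rule (hu X) [pos (pot (c_term U V X))] | U X V. True} \<union>
     {rule (uhu X) [pos (hu X), naf (sortname X)] | X. True} \<union>
     {Rule (Choice None {(eq X Y, [Pos (uhu X), Pos (uhu Y), Cmp (X \<noteq> Y)]) | X Y. True} None) []} \<union>
     {rule (eq X X) [pos (hu X)] | X. True} \<union>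
     {Rule Bot [pos (eq X Y), naf (eq Y X)] | X Y. True} \<union>
     {Rule Bot [pos (eq X Y), pos (eq Y Z), cmp (X \<noteq> Y), cmp (Y \<noteq> Z), cmp (X \<noteq> Z), naf (eq X Z)]
      | X Y Z. True}"

definition P_c :: "patom program" where
  "P_c =
     {rule (factorCluster (c_term P S2 O2) (c_term P S1 O1))
        [pos (fa (c_term P S1 O1)), pos (fa (c_term P S2 O2)), pos (eq S1 S2),
         cmp (tless (c_term P S1 O1) (c_term P S2 O2)), pos (eq O1 O2)]
      | P S1 O1 S2 O2. True} \<union>
     {rule (factorClusterAbove X) [pos (factorCluster X Y)] | X Y. True} \<union>
     {rule (factorVia X Y) [pos (factorCluster X Y), naf (factorClusterAbove Y)] | X Y. True} \<union>
     {rule (factor P) [pos (factorVia P X)] | P X. True} \<union>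
     {rule (abduce P) [pos (fa P), naf (factor P)] | P. True} \<union>
     {rule (fa P) [pos (fai P)] | P. True}"

definition P_BwdA :: "abduction \<Rightarrow> patom program" where
  "P_BwdA A = P_bpt A \<union> P_gp \<union> P_eq \<union> P_c"

text \<open>The additional facts of the rewriting of the axioms that are required for weighted abduction.\<close>

definition P_bodies :: "abduction \<Rightarrow> patom program" where
  "P_bodies A =
     {fact (numberOfBodies (Sym (ident a)) (Num (int (length (batoms a))))) | a. a \<in> axioms A}"

definition P_CARD :: "patom program" where
  "P_CARD = {Weak [pos (abduce P)] 1 1 [P] | P. True}"

definition P_COH :: "patom program" where
  "P_COH =
     {rule (reach P P) [pos (goal P)] | P. True} \<union>
     {rule (reach Q From) [pos (reach P From), pos (inferVia R P), pos (inferenceNeeds P R Q)]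
      | P Q R From. True} \<union>
     {rule (reach Q From) [pos (reach P From), pos (factorVia P Q)] | P Q From. True} \<union>
     {rule (reachFromBoth P Q)
        [pos (goal P), pos (goal Q), cmp (tless P Q), pos (reach N P), pos (reach N Q)]
      | P Q N. True} \<union>
     {Weak [pos (goal P), pos (goal Q), cmp (tless P Q), naf (reachFromBoth P Q)] 1 1 [P, Q]
      | P Q. True}"

text \<open>Only instances with well-defined arithmetic belong to the grounding: in the second rule, \<open>C\<close>
  and \<open>N\<close> are integers and \<open>N\<close> is not 0; a weight is an integer.\<close>

definition P_WA :: "patom program" where
  "P_WA =
     {rule (pcost P (Num 100)) [pos (goal P)] | P. True} \<union>
     {rule (pcost Q Mc)
        [pos (inferVia R P), pos (inferenceNeeds P R Q),
         MaxEq Mc {(Num (asp_div (asp_div (C * 6) 5) N), []), (Num 1, [])},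
         pos (pcost P (Num C)), pos (numberOfBodies R (Num N))]
      | P Q R Mc C N. N \<noteq> 0} \<union>
     {rule (pcost Q C) [pos (factorVia P Q), pos (pcost P C)] | P Q C. True} \<union>
     {rule (cost P C) [pos (abduce P), MinEq C {(Ic, [Pos (pcost P Ic)]) | Ic. True}] | P C. True} \<union>
     {Weak [pos (cost P (Num C))] C 1 [P] | P C. True}"

definition graph_of :: "patom set \<Rightarrow> pgraph" where
  "graph_of I =
     \<lparr>nodes = {P. true P \<in> I},
      bc_edges = {(Q, R, P). inferVia R P \<in> I \<and> inferenceNeeds P R Q \<in> I},
      fac_edges = {(Q, P). factorVia P Q \<in> I}\<rparr>"

end

theory Submission
  imports Defs
begin

text \<open>An answer set is a minimal model of its reduct, so each of its atoms satisfies every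
  property that the rules preserve. This makes all atoms supported and the nodes derivable from the
  goals. The nodes are finitely many, as back-chaining is well-founded and finitely branching. The
  target of a factoring edge is never inferred and its source is the least atom of its cluster, so
  a cycle would consist of back-chaining edges only. For weighted abduction, the program propagates
  every cost while the objective function propagates only the minimum; the two minima agree because
  the rounded cost of a body atom is monotone in the cost of the head.\<close>


section \<open>Answer sets\<close>

text \<open>Support yields only half of each link between \<open>I\<close> and its graph; the other
  half is that \<open>I\<close> is a model. Together they turn the rules into equivalences, from
  which the graph is read off. Two directions of well-foundedness are in play. The acyclicity of the
  axioms bounds the descent from an atom to its body atoms and so makes the node set finite. The
  cost of an atom, however, refers to the atoms that its outgoing edges lead to, so its recursion
  runs along the converse of the edges. Acyclicity of the edges alone does not make this converse
  well-founded; finiteness supplies the rest and gives the definite description in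
  \<open>wa_cost\<close> a meaning. The values in \<open>wcost Q\<close> and the
  \<open>pcost\<close> values of \<open>Q\<close> need not coincide, hence two facts connect them:
  each value in \<open>wcost Q\<close> occurs as a \<open>pcost\<close> value, and each
  \<open>pcost\<close> value is at least \<open>Min (wcost Q)\<close>. Both carry the bound
  \<open>k \<ge> 1\<close>, since truncating division is the floor on nonnegative integers.\<close>

lemma answer_set_induct [consumes 2, case_names head choice]:
  assumes "answer_set P I" and "x \<in> I"
    and head: "\<And>a b. Rule (Head a) b \<in> P \<Longrightarrow> body_sat I b \<Longrightarrow> body_sat {y \<in> I. \<Phi> y} b \<Longrightarrow> \<Phi> a"
    and choice: "\<And>lo es up b a ls. Rule (Choice lo es up) b \<in> P \<Longrightarrow> body_sat I b \<Longrightarrow>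
      body_sat {y \<in> I. \<Phi> y} b \<Longrightarrow> (a, ls) \<in> es \<Longrightarrow> a \<in> I \<Longrightarrow> lits_sat I ls \<Longrightarrow>
      lits_sat {y \<in> I. \<Phi> y} ls \<Longrightarrow> \<Phi> a"
  shows "\<Phi> x"
proof -
  let ?J = "{y \<in> I. \<Phi> y}"
  have model: "is_model P I" and min: "\<And>J. J \<subset> I \<Longrightarrow> \<not> reduct_model P I J"
    using assms(1) by (auto simp: answer_set_def)
  \<comment> \<open>Truth of the body in \<open>?J\<close> hands on \<open>\<Phi>\<close> for the
    positive literals, while truth in \<open>I\<close> keeps what negation and aggregates say about
    \<open>I\<close>. A constraint cannot have a body that is true in the model
    \<open>I\<close>.\<close>
  have "reduct_head_sat I ?J h" if r: "Rule h b \<in> P" "body_sat I b" "body_sat ?J b" for h b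
  proof -
    have h: "head_sat I h"
      using model r by (auto simp: is_model_def)
    show ?thesis
    proof (cases h)
      case (Head a)
      then show ?thesis using h head[of a b] r by simp
    next
      case (Choice lo es up)
      then show ?thesis using choice[of lo es up b] r by auto
    next
      case Bot
      then show ?thesis using h by simp
    qed
  qed
  then have "reduct_model P I ?J"
    by (auto simp: reduct_model_def)
  then have "?J = I"
    using min[of ?J] by blast
  then show ?thesis
    using assms(2) by blast
qed

lemma answer_set_head_sat: "answer_set P I \<Longrightarrow> Rule h b \<in> P \<Longrightarrow> body_sat I b \<Longrightarrow> head_sat I h"
  unfolding answer_set_def is_model_def by blast

lemma answer_set_head: "answer_set P I \<Longrightarrow> Rule (Head a) b \<in> P \<Longrightarrow> body_sat I b \<Longrightarrow> a \<in> I"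
  using answer_set_head_sat[of P I "Head a" b] by simp

lemma answer_set_choice:
  assumes "answer_set P I" "Rule (Choice (Some m) es (Some n)) b \<in> P" "body_sat I b"
  shows "finite (chosen I es)" "m \<le> card (chosen I es)" "card (chosen I es) \<le> n"
proof -
  have "head_sat I (Choice (Some m) es (Some n))"
    using answer_set_head_sat assms by blast
  then show "finite (chosen I es)" "m \<le> card (chosen I es)" "card (chosen I es) \<le> n"
    by auto
qed

lemma answer_set_constraint: "answer_set P I \<Longrightarrow> Rule Bot b \<in> P \<Longrightarrow> \<not> body_sat I b"
  using answer_set_head_sat[of P I Bot b] by auto

section \<open>The order on ground terms, and counting pairs under an order\<close>

lemma tless_asym: "tless t u \<Longrightarrow> \<not> tless u t"
  and tless_args_asym: "tless_args ts us \<Longrightarrow> \<not> tless_args us ts"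
  by (induction t u and ts us rule: tless_tless_args.induct) auto

lemma tless_total: "t \<noteq> u \<Longrightarrow> tless t u \<or> tless u t"
  and tless_args_total: "length ts = length us \<Longrightarrow> ts \<noteq> us \<Longrightarrow> tless_args ts us \<or> tless_args us ts"
  by (induction t u and ts us rule: tless_tless_args.induct) (auto simp: neq_iff)


lemma maxEq_Num_sat:
  "blit_sat I (MaxEq t {(Num x, []), (Num y, [])}) \<longleftrightarrow> t = Num (max x y)"
proof -
  have agg: "agg_terms I {(Num x, []), (Num y, [])} = {Num x, Num y}"
    by (auto simp: agg_terms_def lits_sat_def)
  show ?thesis
    unfolding blit_sat.simps agg
    by (cases x y rule: linorder_cases) (auto simp: tle_def)
qed

text \<open>An orientation that picks exactly one of \<open>(a, b)\<close> and \<open>(b, a)\<close>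
  meets each unordered pair once. As the right-hand side does not mention \<open>R\<close>, the term
  order of the program can be exchanged for the given order \<open>lt\<close>.\<close>

lemma card_oriented_pairs:
  assumes "\<And>a b. R a b \<Longrightarrow> \<not> R b a"
    and "\<And>a b. a \<in> S \<Longrightarrow> b \<in> S \<Longrightarrow> a \<noteq> b \<Longrightarrow> R a b \<or> R b a"
    and "\<And>a b. C a b \<Longrightarrow> C b a"
  shows "card {(a, b). a \<in> S \<and> b \<in> S \<and> R a b \<and> C a b} =
    card {{a, b} | a b. a \<in> S \<and> b \<in> S \<and> a \<noteq> b \<and> C a b}"
proof -
  let ?X = "{(a, b). a \<in> S \<and> b \<in> S \<and> R a b \<and> C a b}"
  have "inj_on (\<lambda>(a, b). {a, b}) ?X"
    using assms(1) by (auto simp: inj_on_def doubleton_eq_iff)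
  moreover have "(\<lambda>(a, b). {a, b}) ` ?X = {{a, b} | a b. a \<in> S \<and> b \<in> S \<and> a \<noteq> b \<and> C a b}"
  proof (intro equalityI subsetI)
    fix z assume "z \<in> (\<lambda>(a, b). {a, b}) ` ?X"
    then show "z \<in> {{a, b} | a b. a \<in> S \<and> b \<in> S \<and> a \<noteq> b \<and> C a b}"
      using assms(1) by clarsimp blast
  next
    fix z assume "z \<in> {{a, b} | a b. a \<in> S \<and> b \<in> S \<and> a \<noteq> b \<and> C a b}"
    then obtain a b where z: "z = {a, b}" "a \<in> S" "b \<in> S" "a \<noteq> b" "C a b"
      by blast
    then have "(a, b) \<in> ?X \<or> (b, a) \<in> ?X"
      using assms(2,3) by blast
    then show "z \<in> (\<lambda>(a, b). {a, b}) ` ?X"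
      using z(1) by force
  qed
  ultimately show ?thesis
    by (metis (no_types, lifting) card_image)
qed


section \<open>The cost function of weighted abduction\<close>

lemma round_cost_mono: "x \<le> y \<Longrightarrow> round_cost x \<le> round_cost y"
  using floor_mono[of x y] by (simp add: round_cost_def max_def)

text \<open>The number to be rounded is \<open>6 * k / (5 * n)\<close>, and the floor of a division
  by a product is reached by dividing by the factors in turn, so truncating twice loses nothing.
  Positivity of \<open>k\<close> makes truncation towards zero the floor.\<close>

lemma round_cost_asp_div:
  assumes "k \<ge> 1" "n > 0"
  shows "round_cost (of_int k * (1.2 / real n)) = of_int (max (asp_div (asp_div (k * 6) 5) (int n)) 1)"
proof -
  have asp: "asp_div x y = x div y" if "x \<ge> 0" "y > 0" for x y
    using that by (cases "x = 0") (auto simp: asp_div_def)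
  have "of_int k * (1.2 / real n) = of_int (k * 6) / of_int (5 * int n)"
    using assms by (simp add: field_simps)
  then have "\<lfloor>of_int k * (1.2 / real n)\<rfloor> = (k * 6) div (5 * int n)"
    by (simp only: floor_divide_of_int_eq)
  also have "\<dots> = asp_div (asp_div (k * 6) 5) (int n)"
    using assms by (simp add: asp pos_imp_zdiv_nonneg_iff zdiv_zmult2_eq)
  finally show ?thesis
    by (simp add: round_cost_def)
qed

text \<open>The right-hand side of the cost equation as an operator on \<open>f\<close>, the form in
  which \<open>wfrec\<close> provides a fixed point.\<close>

definition wa_step ::
  "abduction \<Rightarrow> (gterm \<Rightarrow> real) \<Rightarrow> (axiom \<Rightarrow> nat \<Rightarrow> real) \<Rightarrow> (real \<Rightarrow> real) \<Rightarrow>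
   pgraph \<Rightarrow> (gterm \<Rightarrow> real set) \<Rightarrow> gterm \<Rightarrow> real set" where
  "wa_step A ic w rnd G f Q =
     (if Q \<in> nodes G then
        (if Q \<in> goals A then {ic Q} else {}) \<union>
        {rnd (Min (f P) * w a i) | P a Qs i.
           P \<in> nodes G \<and> f P \<noteq> {} \<and> a \<in> axioms A \<and> back_chain a P Qs \<and>
           i < length Qs \<and> Q = Qs ! i \<and> (Q, Sym (ident a), P) \<in> bc_edges G} \<union>
        {Min (f P) | P. P \<in> nodes G \<and> f P \<noteq> {} \<and> (Q, P) \<in> fac_edges G}
      else {})"

lemma is_wa_cost_step: "is_wa_cost A ic w rnd G f \<longleftrightarrow> f = wa_step A ic w rnd G f"
  unfolding is_wa_cost_def wa_step_def fun_eq_iff ..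

lemma wa_step_mem:
  "v \<in> wa_step A ic w rnd G f Q \<longleftrightarrow> Q \<in> nodes G \<and>
     (Q \<in> goals A \<and> v = ic Q \<or>
      (\<exists>P a Qs i. v = rnd (Min (f P) * w a i) \<and>
         P \<in> nodes G \<and> f P \<noteq> {} \<and> a \<in> axioms A \<and> back_chain a P Qs \<and>
         i < length Qs \<and> Q = Qs ! i \<and> (Q, Sym (ident a), P) \<in> bc_edges G) \<or>
      (\<exists>P. v = Min (f P) \<and> P \<in> nodes G \<and> f P \<noteq> {} \<and> (Q, P) \<in> fac_edges G))"
  unfolding wa_step_def
  by (cases "Q \<in> nodes G"; cases "Q \<in> goals A")
    (simp_all only: if_True if_False Un_iff mem_Collect_eq empty_iff singleton_iff disj_assoc simp_thms)

lemma wa_step_local_subset: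
  assumes local: "\<And>P. (Q, P) \<in> edges G \<Longrightarrow> f P = g P"
  shows "wa_step A ic w rnd G f Q \<subseteq> wa_step A ic w rnd G g Q"
proof
  fix v assume v: "v \<in> wa_step A ic w rnd G f Q"
  then have Q: "Q \<in> nodes G"
    unfolding wa_step_mem by blast
  from v consider "Q \<in> goals A" "v = ic Q"
    | P a Qs i where "v = rnd (Min (f P) * w a i)" "P \<in> nodes G" "f P \<noteq> {}" "a \<in> axioms A"
        "back_chain a P Qs" "i < length Qs" "Q = Qs ! i" "(Q, Sym (ident a), P) \<in> bc_edges G"
    | P where "v = Min (f P)" "P \<in> nodes G" "f P \<noteq> {}" "(Q, P) \<in> fac_edges G"
    unfolding wa_step_mem by blast
  then show "v \<in> wa_step A ic w rnd G g Q"
  proof cases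
    case 1
    then show ?thesis using Q unfolding wa_step_mem by blast
  next
    case (2 P a Qs i)
    then have "f P = g P"
      by (intro local) (auto simp: edges_def)
    then have "v = rnd (Min (g P) * w a i)" "g P \<noteq> {}"
      using 2 by simp_all
    then show ?thesis using Q 2 unfolding wa_step_mem by blast
  next
    case (3 P)
    then have "f P = g P"
      by (intro local) (auto simp: edges_def)
    then have "v = Min (g P)" "g P \<noteq> {}"
      using 3 by simp_all
    then show ?thesis using Q 3 unfolding wa_step_mem by blast
  qed
qed

lemma wa_step_local:
  assumes "\<And>P. (Q, P) \<in> edges G \<Longrightarrow> f P = g P"
  shows "wa_step A ic w rnd G f Q = wa_step A ic w rnd G g Q"
  using wa_step_local_subset[of Q G f g] wa_step_local_subset[of Q G g f] assms by fastforce

text \<open>The operator consults \<open>f\<close> only at the ends of edges that leave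
  \<open>Q\<close>, so it is admissible for recursion along the converse of the edges and has a
  fixed point. Well-founded induction makes this unique, and the description in
  \<open>wa_cost\<close> denotes it.\<close>

lemma wa_cost_step:
  assumes "wf ((edges G)\<inverse>)"
  shows "wa_cost A ic w rnd G = wa_step A ic w rnd G (wa_cost A ic w rnd G)"
proof -
  let ?F = "wa_step A ic w rnd G"
  have "adm_wf ((edges G)\<inverse>) ?F"
    unfolding adm_wf_def using wa_step_local[of _ G] by blast
  from wfrec_fixpoint[OF assms this] have ex: "is_wa_cost A ic w rnd G (wfrec ((edges G)\<inverse>) ?F)"
    by (simp add: is_wa_cost_step)
  have "f = g" if "is_wa_cost A ic w rnd G f" "is_wa_cost A ic w rnd G g" for f g
  proof
    fix Q
    show "f Q = g Q"
      using assms
    proof (induction Q rule: wf_induct_rule)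
      case (less Q)
      then have "?F f Q = ?F g Q"
        by (intro wa_step_local) auto
      then show ?case
        using that by (metis is_wa_cost_step)
    qed
  qed
  then have "is_wa_cost A ic w rnd G (wa_cost A ic w rnd G)"
    unfolding wa_cost_def using ex by (metis theI)
  then show ?thesis
    by (simp only: is_wa_cost_step)
qed


section \<open>Back-chaining\<close>

lemma inst_eqD:
  assumes "inst \<sigma> p = inst \<tau> p" "v \<in> set (atom_vars p)"
  shows "\<sigma> v = \<tau> v"
proof (cases p)
  case (Atom q x y)
  then show ?thesis using assms by (cases x; cases y) auto
qed

lemma inst_head_eqD:
  assumes "inst \<sigma> (hatom a) = inst \<tau> (hatom a)"
  shows "v \<in> set (head_vars a) \<Longrightarrow> \<sigma> v = \<tau> v"
    and "map \<sigma> (head_vars a) = map \<tau> (head_vars a)"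
  using inst_eqD[OF assms] by (auto simp: head_vars_def)

lemma inst_cong:
  assumes "\<And>v. v \<in> set (atom_vars p) \<Longrightarrow> \<sigma> v = \<tau> v"
  shows "inst \<sigma> p = inst \<tau> p"
proof (cases p)
  case (Atom q x y)
  then show ?thesis using assms by (cases x; cases y) auto
qed

lemma body_vars_cases:
  assumes "p \<in> set (batoms a)" "v \<in> set (atom_vars p)"
  shows "v \<in> set (head_vars a) \<or> v \<in> set (inv_vars a)"
  using assms by (auto simp: inv_vars_def body_vars_def)

text \<open>\<open>P\<close> fixes the substitution on the head variables, the Skolem equations then
  fix it on the invented ones, and these two kinds cover the body.\<close>

lemma back_chain_unique:
  assumes "back_chain a P Qs" "back_chain a P Qs'"
  shows "Qs = Qs'"
proof -
  obtain \<sigma> where s: "P = inst \<sigma> (hatom a)"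
    "\<forall>i < length (inv_vars a). \<sigma> (inv_vars a ! i) = s_term (ident a) (Suc i) (map \<sigma> (head_vars a))"
    "Qs = map (inst \<sigma>) (batoms a)"
    using assms(1) by (auto simp: back_chain_def)
  obtain \<tau> where t: "P = inst \<tau> (hatom a)"
    "\<forall>i < length (inv_vars a). \<tau> (inv_vars a ! i) = s_term (ident a) (Suc i) (map \<tau> (head_vars a))"
    "Qs' = map (inst \<tau>) (batoms a)"
    using assms(2) by (auto simp: back_chain_def)
  have eq: "inst \<sigma> (hatom a) = inst \<tau> (hatom a)"
    using s(1) t(1) by simp
  note h = inst_head_eqD(1)[OF eq] and m = inst_head_eqD(2)[OF eq]
  have "\<sigma> v = \<tau> v" if "v \<in> set (inv_vars a)" for v
    using that s(2) t(2) m by (auto simp: in_set_conv_nth)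
  then have "inst \<sigma> p = inst \<tau> p" if "p \<in> set (batoms a)" for p
    using that h body_vars_cases by (blast intro: inst_cong)
  then show ?thesis
    using s(3) t(3) by simp
qed

lemma back_chain_length: "back_chain a P Qs \<Longrightarrow> length Qs = length (batoms a)"
  by (auto simp: back_chain_def)

text \<open>By uniqueness each axiom contributes at most one list of body atoms, which the
  description selects.\<close>

lemma finite_back_chain_predecessors:
  assumes "finite B"
  shows "finite {Q. \<exists>a\<in>B. \<exists>Qs. back_chain a P Qs \<and> Q \<in> set Qs}"
proof (rule finite_subset)
  have "(THE Qs. back_chain a P Qs) = Qs" if "back_chain a P Qs" for a Qs
    using that back_chain_unique by (blast intro: the_equality)
  then show "{Q. \<exists>a\<in>B. \<exists>Qs. back_chain a P Qs \<and> Q \<in> set Qs} \<subseteq>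
      (\<Union>a\<in>B. set (THE Qs. back_chain a P Qs))"
    by auto
qed (use assms in auto)

text \<open>Koenig's lemma as an induction: what lies below \<open>y\<close> is \<open>y\<close>
  itself and what lies below its finitely many predecessors.\<close>

lemma finite_wf_predecessors:
  assumes "wf r" "\<And>y. finite {x. (x, y) \<in> r}"
  shows "finite {x. (x, y) \<in> r\<^sup>*}"
  using assms(1)
proof (induction y rule: wf_induct_rule)
  case (less y)
  have "{x. (x, y) \<in> r\<^sup>*} \<subseteq> insert y (\<Union>z\<in>{z. (z, y) \<in> r}. {x. (x, z) \<in> r\<^sup>*})"
    by (auto elim: rtranclE)
  then show ?case
    using less assms(2) by (auto elim: finite_subset)
qed


section \<open>Support of the atoms of an answer set\<close>

definition back_graph :: "patom set \<Rightarrow> (gterm \<times> gterm) set" where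
  "back_graph I = {(Q, P). \<exists>R. inferVia R P \<in> I \<and> inferenceNeeds P R Q \<in> I}"

text \<open>Factoring adds no nodes, hence only back-chaining is followed.\<close>

definition derived :: "abduction \<Rightarrow> patom set \<Rightarrow> gterm set" where
  "derived A I = {P. \<exists>g\<in>goals A. (P, g) \<in> (back_graph I)\<^sup>*}"

text \<open>Premises are mostly recorded as membership in \<open>I\<close>, which the induction
  provides along with support. \<open>infer\<close> and \<open>inferVia\<close> also hand on that
  \<open>P\<close> is derived, because the rule that makes a body atom true sees
  \<open>true P\<close> only through \<open>inferVia\<close>. The bound for \<open>pcost\<close> has
  an induction of its own: it needs the cost equation, which rests on the finiteness and acyclicity
  obtained from support.\<close>

fun supported :: "abduction \<Rightarrow> patom set \<Rightarrow> patom \<Rightarrow> bool" where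
  "supported A I (goal P) \<longleftrightarrow> P \<in> goals A"
| "supported A I (sortname t) \<longleftrightarrow> t \<in> Sym ` sorts A"
| "supported A I (mayInferVia R P L) \<longleftrightarrow>
     (\<exists>a\<in>axioms A. \<exists>\<sigma>. R = Sym (ident a) \<and> P = inst \<sigma> (hatom a) \<and> L = l_term (map \<sigma> (inv_vars a)) \<and>
       (\<forall>i < length (inv_vars a).
          \<sigma> (inv_vars a ! i) = s_term (ident a) (Suc i) (map \<sigma> (head_vars a))))"
| "supported A I (inferenceNeeds P R Q) \<longleftrightarrow>
     (\<exists>a\<in>axioms A. \<exists>Qs. R = Sym (ident a) \<and> back_chain a P Qs \<and> Q \<in> set Qs)"
| "supported A I (numberOfBodies R N) \<longleftrightarrow>
     (\<exists>a\<in>axioms A. R = Sym (ident a) \<and> N = Num (int (length (batoms a))))"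
| "supported A I (pot P) \<longleftrightarrow> True"
| "supported A I (true P) \<longleftrightarrow> P \<in> derived A I"
| "supported A I (infer P) \<longleftrightarrow> true P \<in> I \<and> P \<in> derived A I"
| "supported A I (fai P) \<longleftrightarrow> true P \<in> I"
| "supported A I (inferVia R P) \<longleftrightarrow> infer P \<in> I \<and> P \<in> derived A I \<and> (\<exists>L. mayInferVia R P L \<in> I)"
| "supported A I (hu X) \<longleftrightarrow> True"
| "supported A I (uhu X) \<longleftrightarrow> hu X \<in> I \<and> sortname X \<notin> I"
| "supported A I (eq X Y) \<longleftrightarrow> (if X = Y then hu X \<in> I else uhu X \<in> I \<and> uhu Y \<in> I)"
| "supported A I (fa P) \<longleftrightarrow> fai P \<in> I"
| "supported A I (factorCluster X Y) \<longleftrightarrow>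
     (\<exists>p s s' t t'. X = c_term p s' t' \<and> Y = c_term p s t \<and> fa X \<in> I \<and> fa Y \<in> I \<and>
        eq s s' \<in> I \<and> eq t t' \<in> I \<and> tless Y X)"
| "supported A I (factorClusterAbove X) \<longleftrightarrow> (\<exists>Y. factorCluster X Y \<in> I)"
| "supported A I (factorVia X Y) \<longleftrightarrow> factorCluster X Y \<in> I \<and> factorClusterAbove Y \<notin> I"
| "supported A I (factor P) \<longleftrightarrow> (\<exists>X. factorVia P X \<in> I)"
| "supported A I (abduce P) \<longleftrightarrow> fa P \<in> I \<and> factor P \<notin> I"
| "supported A I (reach Q P) \<longleftrightarrow> P \<in> goals A \<and> (Q, P) \<in> (edges (graph_of I))\<^sup>*"
| "supported A I (reachFromBoth P Q) \<longleftrightarrow> (\<exists>N. reach N P \<in> I \<and> reach N Q \<in> I)"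
| "supported A I (pcost Q C) \<longleftrightarrow> True"
| "supported A I (cost P C) \<longleftrightarrow>
     abduce P \<in> I \<and> pcost P C \<in> I \<and> (\<forall>D. pcost P D \<in> I \<longrightarrow> tle C D)"

text \<open>The union of all programs, so that one induction on support serves each of the three.\<close>

definition P_all :: "abduction \<Rightarrow> patom program" where
  "P_all A = P_BwdA A \<union> P_bodies A \<union> P_CARD \<union> P_COH \<union> P_WA"

lemmas P_all_defs = P_all_def P_BwdA_def P_bpt_def P_gp_def P_eq_def P_c_def P_bodies_def
  P_CARD_def P_COH_def P_WA_def

text \<open>The lower bound on \<open>prog\<close> lets every rule of the encoding fire; the upper
  bound limits the rules that can support an atom. Rules of one objective function enter later as
  extra inclusions such as \<open>P_COH \<subseteq> prog\<close>.\<close>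

locale bwd_answer_set =
  fixes A :: abduction and prog :: "patom program" and I :: "patom set"
  assumes inst: "abduction_instance A"
    and ans: "answer_set prog I"
    and base: "P_BwdA A \<subseteq> prog"
    and sub: "prog \<subseteq> P_all A"
begin

lemma ident_inj: "a \<in> axioms A \<Longrightarrow> b \<in> axioms A \<Longrightarrow> ident a = ident b \<Longrightarrow> a = b"
  using inst by (auto simp: abduction_instance_def inj_on_def)

text \<open>The second premise is the simplified form of the Skolem equations in the rule body, with
  \<open>int (Suc i)\<close> turned into \<open>1 + int i\<close>.\<close>

lemma supported_mayInferVia:
  assumes "a \<in> axioms A"
    and "\<forall>i\<in>{0..<length (inv_vars a)}.
      \<sigma> (inv_vars a ! i) = Fn (STR ''s'') (Sym (ident a) # Num (1 + int i) # map \<sigma> (head_vars a))"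
  shows "supported A I (mayInferVia (Sym (ident a)) (inst \<sigma> (hatom a)) (l_term (map \<sigma> (inv_vars a))))"
  unfolding supported.simps
  by (intro bexI[of _ a] exI[of _ \<sigma>]) (use assms in auto)

text \<open>The rule body does not repeat the Skolem equations. They are recovered from the support
  of \<open>mayInferVia\<close>: its witness uses the same axiom, as identifiers are injective, and
  agrees with \<open>\<sigma>\<close> on the head variables and on the arguments of the
  \<open>l\<close> term.\<close>

lemma supported_inferenceNeeds:
  assumes "supported A I (mayInferVia (Sym (ident a)) (inst \<sigma> (hatom a)) (l_term (map \<sigma> (inv_vars a))))"
    and "a \<in> axioms A" "p \<in> set (batoms a)"
  shows "supported A I (inferenceNeeds (inst \<sigma> (hatom a)) (Sym (ident a)) (inst \<sigma> p))"
proof -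
  obtain b \<tau> where b: "b \<in> axioms A" "ident a = ident b"
    "inst \<sigma> (hatom a) = inst \<tau> (hatom b)" "map \<sigma> (inv_vars a) = map \<tau> (inv_vars b)"
    "\<forall>i < length (inv_vars b). \<tau> (inv_vars b ! i) = s_term (ident b) (Suc i) (map \<tau> (head_vars b))"
    using assms(1) by auto
  have [simp]: "b = a"
    using b assms ident_inj by metis
  have "map \<sigma> (head_vars a) = map \<tau> (head_vars a)"
    using b(3) inst_head_eqD(2) by simp
  moreover have "\<sigma> (inv_vars a ! i) = \<tau> (inv_vars a ! i)" if "i < length (inv_vars a)" for i
    using b(4) that by simp
  ultimately have "back_chain a (inst \<sigma> (hatom a)) (map (inst \<sigma>) (batoms a))"
    using b(5) by (auto simp: back_chain_def)
  then show ?thesis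
    unfolding supported.simps
    by (intro bexI[of _ a] exI[of _ "map (inst \<sigma>) (batoms a)"]) (use assms in auto)
qed

lemma derived_goal: "g \<in> goals A \<Longrightarrow> g \<in> derived A I"
  by (auto simp: derived_def)

lemma derived_step: "P \<in> derived A I \<Longrightarrow> inferVia R P \<in> I \<Longrightarrow> inferenceNeeds P R Q \<in> I \<Longrightarrow> Q \<in> derived A I"
  unfolding derived_def back_graph_def by (blast intro: converse_rtrancl_into_rtrancl)

lemma edges_graph_of:
  "(Q, P) \<in> edges (graph_of I) \<longleftrightarrow>
     (\<exists>R. inferVia R P \<in> I \<and> inferenceNeeds P R Q \<in> I) \<or> factorVia P Q \<in> I"
  by (auto simp: edges_def graph_of_def)

lemma edges_step_infer:
  "(P, g) \<in> (edges (graph_of I))\<^sup>* \<Longrightarrow> inferVia R P \<in> I \<Longrightarrow> inferenceNeeds P R Q \<in> I \<Longrightarrow>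
   (Q, g) \<in> (edges (graph_of I))\<^sup>*"
  by (rule converse_rtrancl_into_rtrancl) (auto simp: edges_graph_of)

lemma edges_step_factor:
  "(P, g) \<in> (edges (graph_of I))\<^sup>* \<Longrightarrow> factorVia P Q \<in> I \<Longrightarrow> (Q, g) \<in> (edges (graph_of I))\<^sup>*"
  by (rule converse_rtrancl_into_rtrancl) (auto simp: edges_graph_of)

lemma supported_head:
  assumes "Rule (Head a) b \<in> P_all A" "body_sat I b" "body_sat {y \<in> I. supported A I y} b"
  shows "supported A I a"
  using assms
  unfolding P_all_defs Un_iff mem_Collect_eq
  apply (elim disjE exE conjE)
  apply (simp_all add: body_sat_def lits_sat_def agg_terms_def
      derived_goal supported_mayInferVia del: supported.simps(3,4))
  apply (simp_all add: supported_inferenceNeeds del: supported.simps(3,4))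
  apply (blast intro: derived_step edges_step_infer edges_step_factor)+
  done

lemma P_all_choice:
  assumes "Rule (Choice lo es up) b \<in> P_all A" "(a, ls) \<in> es"
  shows "(\<exists>Q. (a = infer Q \<or> a = fai Q) \<and> b = [pos (true Q)]) \<or>
     (\<exists>R Q L. a = inferVia R Q \<and> ls = [Pos (mayInferVia R Q L)] \<and> b = [pos (infer Q)]) \<or>
     (\<exists>X Y. a = eq X Y \<and> ls = [Pos (uhu X), Pos (uhu Y), Cmp (X \<noteq> Y)])"
proof -
  have "Rule (Choice lo es up) b \<in> P_gp \<union> P_eq"
    using assms(1) by (auto simp: P_all_def P_BwdA_def P_bpt_def P_c_def P_bodies_def
      P_CARD_def P_COH_def P_WA_def)
  then show ?thesis
    using assms(2) by (auto simp: P_gp_def P_eq_def)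
qed

lemma P_all_pcost:
  assumes "Rule (Head (pcost Q C)) b \<in> P_all A"
  shows "(b = [pos (goal Q)] \<and> C = Num 100) \<or>
    (\<exists>P R k N. b = [pos (inferVia R P), pos (inferenceNeeds P R Q),
       MaxEq C {(Num (asp_div (asp_div (k * 6) 5) N), []), (Num 1, [])},
       pos (pcost P (Num k)), pos (numberOfBodies R (Num N))]) \<or>
    (\<exists>P. b = [pos (factorVia P Q), pos (pcost P C)])"
proof -
  have "Rule (Head (pcost Q C)) b \<in> P_WA"
    using assms by (auto simp: P_all_def P_BwdA_def P_bpt_def P_gp_def P_eq_def P_c_def
      P_bodies_def P_CARD_def P_COH_def)
  then show ?thesis
    unfolding P_WA_def by auto
qed

text \<open>This is the only-if half of the equivalences for the atoms of \<open>I\<close>; firing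
  the rules gives the if half.\<close>

lemma supp:
  assumes "x \<in> I"
  shows "supported A I x"
  using ans assms
proof (induction x rule: answer_set_induct)
  case (head a b)
  show ?case
    using supported_head[OF subsetD[OF sub head(1)] head(2,3)] .
next
  case (choice lo es up b a ls)
  consider Q where "a = infer Q \<or> a = fai Q" "b = [pos (true Q)]"
    | R Q L where "a = inferVia R Q" "ls = [Pos (mayInferVia R Q L)]" "b = [pos (infer Q)]"
    | X Y where "a = eq X Y" "ls = [Pos (uhu X), Pos (uhu Y), Cmp (X \<noteq> Y)]"
    using P_all_choice[OF subsetD[OF sub choice(1)] choice(3)] by blast
  then show ?case
    using choice by cases (auto simp: body_sat_def lits_sat_def)
qed


section \<open>The rules of the encoding read as equivalences\<close>

lemma subprogram_head: "Q \<subseteq> prog \<Longrightarrow> Rule (Head a) b \<in> Q \<Longrightarrow> body_sat I b \<Longrightarrow> a \<in> I"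
  using answer_set_head[OF ans] by blast

lemmas base_head = subprogram_head[OF base]

lemma goal_iff: "goal g \<in> I \<longleftrightarrow> g \<in> goals A"
proof
  assume "g \<in> goals A"
  then show "goal g \<in> I"
    by (intro base_head[of _ "[]"]) (auto simp: P_BwdA_def P_bpt_def body_sat_def)
qed (use supp in force)

lemma sortname_sorts: "s \<in> sorts A \<Longrightarrow> sortname (Sym s) \<in> I"
  by (intro base_head[of _ "[]"]) (auto simp: P_BwdA_def P_bpt_def body_sat_def)

lemma true_goal: "g \<in> goals A \<Longrightarrow> true g \<in> I"
  by (intro base_head[of _ "[pos (goal g)]"]) (auto simp: P_BwdA_def P_gp_def body_sat_def goal_iff)

lemma true_step: "inferVia R P \<in> I \<Longrightarrow> inferenceNeeds P R Q \<in> I \<Longrightarrow> true Q \<in> I"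
  by (intro base_head[of _ "[pos (inferVia R P), pos (inferenceNeeds P R Q)]"])
    (auto simp: P_BwdA_def P_gp_def body_sat_def)

lemma derived_induct [consumes 1, case_names goal step]:
  assumes "P \<in> derived A I"
    and "\<And>g. g \<in> goals A \<Longrightarrow> \<Phi> g"
    and "\<And>P Q R. P \<in> derived A I \<Longrightarrow> \<Phi> P \<Longrightarrow> inferVia R P \<in> I \<Longrightarrow> inferenceNeeds P R Q \<in> I \<Longrightarrow> \<Phi> Q"
  shows "\<Phi> P"
proof -
  obtain g where g: "g \<in> goals A" "(P, g) \<in> (back_graph I)\<^sup>*"
    using assms(1) by (auto simp: derived_def)
  from g(2) have "P \<in> derived A I \<and> \<Phi> P"
  proof (induction rule: converse_rtrancl_induct)
    case base
    then show ?case using g(1) assms(2) derived_goal by blast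
  next
    case (step Q P)
    then obtain R where "inferVia R P \<in> I" "inferenceNeeds P R Q \<in> I"
      by (auto simp: back_graph_def)
    then show ?case
      using step.IH assms(3) derived_step by blast
  qed
  then show ?thesis by blast
qed

lemma true_iff_derived: "true P \<in> I \<longleftrightarrow> P \<in> derived A I"
proof
  assume "P \<in> derived A I"
  then show "true P \<in> I"
    by (induction rule: derived_induct) (auto intro: true_goal true_step)
qed (use supp in force)

lemma infer_fai_exclusive:
  assumes "true P \<in> I"
  shows "infer P \<in> I \<longleftrightarrow> fai P \<notin> I"
proof -
  let ?es = "{(infer P, []), (fai P, [])}"
  have "Rule (Choice (Some 1) ?es (Some 1)) [pos (true P)] \<in> prog"
    using base by (auto simp: P_BwdA_def P_gp_def)
  from answer_set_choice[OF ans this] have "card (chosen I ?es) = 1"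
    using assms by (auto simp: body_sat_def)
  moreover have "chosen I ?es = {infer P, fai P} \<inter> I"
    by (auto simp: chosen_def lits_sat_def)
  ultimately have "card ({infer P, fai P} \<inter> I) = 1"
    by simp
  then show ?thesis
    by (cases "infer P \<in> I"; cases "fai P \<in> I") auto
qed

lemma fai_true: "fai P \<in> I \<Longrightarrow> true P \<in> I"
  using supp by force

lemma fa_iff: "fa P \<in> I \<longleftrightarrow> fai P \<in> I"
proof
  assume "fai P \<in> I"
  then show "fa P \<in> I"
    by (intro base_head[of _ "[pos (fai P)]"]) (auto simp: P_BwdA_def P_c_def body_sat_def)
qed (use supp in force)

lemma inferVia_infer: "inferVia R P \<in> I \<Longrightarrow> infer P \<in> I"
  using supp by force

lemma infer_inferVia_ex1:
  assumes "infer P \<in> I"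
  shows "\<exists>!R. inferVia R P \<in> I"
proof -
  define es where "es = {(inferVia R P, [Pos (mayInferVia R P L)]) | R L. True}"
  have "Rule (Choice (Some 1) es (Some 1)) [pos (infer P)] \<in> prog"
    using base unfolding es_def P_BwdA_def P_gp_def by blast
  from answer_set_choice[OF ans this] have "card (chosen I es) = 1"
    using assms by (simp add: body_sat_def)
  then obtain x where x: "chosen I es = {x}"
    by (auto simp: card_1_singleton_iff)
  \<comment> \<open>The bounds of a choice count only atoms whose condition holds. Support supplies
    the term \<open>L\<close> for which the condition \<open>mayInferVia R P L\<close> does.\<close>
  have chosen: "inferVia R P \<in> chosen I es" if R: "inferVia R P \<in> I" for R
  proof -
    obtain L where "mayInferVia R P L \<in> I"
      using supp[OF R] by auto
    then have "lits_sat I [Pos (mayInferVia R P L)]"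
      by (simp add: lits_sat_def)
    moreover have "(inferVia R P, [Pos (mayInferVia R P L)]) \<in> es"
      by (simp add: es_def)
    ultimately show ?thesis
      using R unfolding chosen_def by blast
  qed
  have "x \<in> chosen I es"
    using x by simp
  then obtain R where "x = inferVia R P" "inferVia R P \<in> I"
    unfolding chosen_def es_def by blast
  moreover have "inferVia R' P = x" if "inferVia R' P \<in> I" for R'
    using chosen[OF that] x by simp
  ultimately show ?thesis
    by (metis patom.inject(10))
qed

lemma inferVia_unique: "inferVia R P \<in> I \<Longrightarrow> inferVia R' P \<in> I \<Longrightarrow> R = R'"
  using infer_inferVia_ex1 inferVia_infer by blast

text \<open>Injective identifiers and uniqueness of back-chaining exclude body atoms from other
  axioms or other instances, so \<open>inferenceNeeds\<close> lists exactly one back-chaining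
  step.\<close>

lemma inferVia_back_chain:
  assumes "inferVia R P \<in> I"
  obtains a Qs where "a \<in> axioms A" "R = Sym (ident a)" "back_chain a P Qs"
    "\<And>Q. inferenceNeeds P R Q \<in> I \<longleftrightarrow> Q \<in> set Qs"
proof -
  obtain L where L: "mayInferVia R P L \<in> I"
    using supp[OF assms] by auto
  then obtain a \<sigma> where a: "a \<in> axioms A" "R = Sym (ident a)" "P = inst \<sigma> (hatom a)"
    "L = l_term (map \<sigma> (inv_vars a))"
    "\<forall>i < length (inv_vars a). \<sigma> (inv_vars a ! i) = s_term (ident a) (Suc i) (map \<sigma> (head_vars a))"
    using supp[OF L] unfolding supported.simps by blast
  let ?Qs = "map (inst \<sigma>) (batoms a)"
  have chain: "back_chain a P ?Qs"
    using a by (auto simp: back_chain_def)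
  have "inferenceNeeds P R Q \<in> I" if Q: "Q \<in> set ?Qs" for Q
  proof -
    obtain p where "p \<in> set (batoms a)" "Q = inst \<sigma> p"
      using Q by auto
    then obtain i where i: "i < length (batoms a)" "Q = inst \<sigma> (batoms a ! i)"
      by (auto simp: in_set_conv_nth)
    have "rule (inferenceNeeds (inst \<sigma> (hatom a)) (Sym (ident a)) (inst \<sigma> (batoms a ! i)))
        [pos (mayInferVia (Sym (ident a)) (inst \<sigma> (hatom a)) (l_term (map \<sigma> (inv_vars a))))]
      \<in> P_BwdA A"
      unfolding P_BwdA_def P_bpt_def using a(1) i(1) by blast
    from base_head[OF this] show ?thesis
      using L a i by (simp add: body_sat_def)
  qed
  moreover have "Q \<in> set ?Qs" if Q: "inferenceNeeds P R Q \<in> I" for Q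
  proof -
    obtain a' Qs' where a': "a' \<in> axioms A" "R = Sym (ident a')" "back_chain a' P Qs'" "Q \<in> set Qs'"
      using supp[OF Q] by auto
    then have "a' = a"
      using a ident_inj by simp
    then show ?thesis
      using a' chain back_chain_unique by blast
  qed
  ultimately show ?thesis
    using that[OF a(1,2) chain] by blast
qed

lemma factorCluster_iff:
  "factorCluster (c_term p s' t') (c_term p s t) \<in> I \<longleftrightarrow>
     fai (c_term p s' t') \<in> I \<and> fai (c_term p s t) \<in> I \<and> eq s s' \<in> I \<and> eq t t' \<in> I \<and>
     tless (c_term p s t) (c_term p s' t')"
  (is "?l \<longleftrightarrow> ?r")
proof
  assume ?l
  then show ?r using supp[OF \<open>?l\<close>] by (simp only: supported.simps fa_iff) auto
next
  assume ?r
  then show ?l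
    by (intro base_head[of _ "[pos (fa (c_term p s t)), pos (fa (c_term p s' t')), pos (eq s s'),
        cmp (tless (c_term p s t) (c_term p s' t')), pos (eq t t')]"])
      (auto simp: P_BwdA_def P_c_def body_sat_def fa_iff)
qed

lemma factorVia_iff: "factorVia X Y \<in> I \<longleftrightarrow> factorCluster X Y \<in> I \<and> factorClusterAbove Y \<notin> I"
proof
  assume "factorCluster X Y \<in> I \<and> factorClusterAbove Y \<notin> I"
  then show "factorVia X Y \<in> I"
    by (intro base_head[of _ "[pos (factorCluster X Y), naf (factorClusterAbove Y)]"])
      (auto simp: P_BwdA_def P_c_def body_sat_def)
qed (use supp in force)

lemma factorClusterAbove_iff: "factorClusterAbove X \<in> I \<longleftrightarrow> (\<exists>Y. factorCluster X Y \<in> I)"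
proof
  assume "\<exists>Y. factorCluster X Y \<in> I"
  then obtain Y where "factorCluster X Y \<in> I" ..
  then show "factorClusterAbove X \<in> I"
    by (intro base_head[of _ "[pos (factorCluster X Y)]"])
      (auto simp: P_BwdA_def P_c_def body_sat_def)
qed (use supp in force)

lemma factor_iff: "factor X \<in> I \<longleftrightarrow> (\<exists>Y. factorVia X Y \<in> I)"
proof
  assume "\<exists>Y. factorVia X Y \<in> I"
  then obtain Y where "factorVia X Y \<in> I" ..
  then show "factor X \<in> I"
    by (intro base_head[of _ "[pos (factorVia X Y)]"])
      (auto simp: P_BwdA_def P_c_def body_sat_def)
qed (use supp in force)

lemma abduce_iff: "abduce X \<in> I \<longleftrightarrow> fai X \<in> I \<and> factor X \<notin> I"
proof
  assume "fai X \<in> I \<and> factor X \<notin> I"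
  then show "abduce X \<in> I"
    by (intro base_head[of _ "[pos (fa X), naf (factor X)]"])
      (auto simp: P_BwdA_def P_c_def body_sat_def fa_iff)
next
  assume "abduce X \<in> I"
  from supp[OF this] show "fai X \<in> I \<and> factor X \<notin> I"
    by (simp add: fa_iff)
qed

lemma hu_if_eq: "eq X Y \<in> I \<Longrightarrow> hu X \<in> I"
proof -
  assume "eq X Y \<in> I"
  from supp[OF this] have "hu X \<in> I \<or> uhu X \<in> I"
    by (auto split: if_splits)
  then show ?thesis
    using supp by force
qed

lemma eq_refl: "eq X Y \<in> I \<Longrightarrow> eq X X \<in> I"
  by (intro base_head[of _ "[pos (hu X)]"])
    (auto simp: P_BwdA_def P_eq_def body_sat_def dest: hu_if_eq)

lemma eq_sym: "eq X Y \<in> I \<Longrightarrow> eq Y X \<in> I"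
proof -
  have "Rule Bot [pos (eq X Y), naf (eq Y X)] \<in> prog"
    using base by (auto simp: P_BwdA_def P_eq_def)
  from answer_set_constraint[OF ans this] show "eq X Y \<in> I \<Longrightarrow> eq Y X \<in> I"
    by (auto simp: body_sat_def)
qed

lemma eq_trans: "eq X Y \<in> I \<Longrightarrow> eq Y Z \<in> I \<Longrightarrow> eq X Z \<in> I"
proof -
  assume XYZ: "eq X Y \<in> I" "eq Y Z \<in> I"
  have "Rule Bot [pos (eq X Y), pos (eq Y Z), cmp (X \<noteq> Y), cmp (Y \<noteq> Z), cmp (X \<noteq> Z), naf (eq X Z)] \<in> prog"
    using base unfolding P_BwdA_def P_eq_def by blast
  \<comment> \<open>The constraint speaks of three distinct terms only. If \<open>Y\<close> equals
    \<open>X\<close> or \<open>Z\<close>, the claim is one of the premises; if \<open>X = Z\<close>,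
    it is reflexivity.\<close>
  from answer_set_constraint[OF ans this] have "X = Y \<or> Y = Z \<or> X = Z \<or> eq X Z \<in> I"
    using XYZ by (auto simp: body_sat_def)
  then show ?thesis
    using XYZ eq_refl by blast
qed

text \<open>Distinct terms are equated only by the guess over \<open>uhu\<close>, which excludes
  sort names. This is the side condition of unification in \<open>generates\<close>.\<close>

lemma eq_not_sort: "eq X Y \<in> I \<Longrightarrow> X \<noteq> Y \<Longrightarrow> X \<notin> Sym ` sorts A \<and> Y \<notin> Sym ` sorts A"
proof -
  assume e: "eq X Y \<in> I" "X \<noteq> Y"
  have "uhu X \<in> I" "uhu Y \<in> I"
    using supp[OF e(1)] e(2) by auto
  then have "sortname X \<notin> I" "sortname Y \<notin> I"
    using supp by force+
  then show ?thesis
    using sortname_sorts by blast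
qed

text \<open>Two targets have arguments equal to those of \<open>X\<close>, hence to each other by
  symmetry and transitivity. By totality of the term order one of them is then clustered with the
  smaller one, although neither target has anything below it in its cluster.\<close>

lemma factorVia_unique:
  assumes "factorVia X Y \<in> I" "factorVia X Y' \<in> I"
  shows "Y = Y'"
proof (rule ccontr)
  assume ne: "Y \<noteq> Y'"
  have cl: "factorCluster X Y \<in> I" "factorCluster X Y' \<in> I"
    and min: "factorClusterAbove Y \<notin> I" "factorClusterAbove Y' \<notin> I"
    using assms by (auto simp: factorVia_iff)
  obtain p s t u v where Y: "X = c_term p s t" "Y = c_term p u v"
    using supp[OF cl(1)] by auto
  obtain u' v' where Y': "Y' = c_term p u' v'"
    using supp[OF cl(2)] Y(1) by auto
  have *: "fai Y \<in> I" "fai Y' \<in> I" "eq u s \<in> I" "eq v t \<in> I" "eq u' s \<in> I" "eq v' t \<in> I"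
    using cl unfolding Y Y' factorCluster_iff by auto
  have "tless Y Y' \<or> tless Y' Y"
    using ne tless_total by blast
  then have "factorCluster Y' Y \<in> I \<or> factorCluster Y Y' \<in> I"
    using * eq_trans eq_sym unfolding Y Y' factorCluster_iff by blast
  then show False
    using min factorClusterAbove_iff by blast
qed

lemma factorVia_fai: "factorVia X Y \<in> I \<Longrightarrow> fai X \<in> I \<and> fai Y \<in> I"
proof -
  assume "factorVia X Y \<in> I"
  then have *: "factorCluster X Y \<in> I"
    by (simp add: factorVia_iff)
  from supp[OF this] show ?thesis
    using fa_iff by auto
qed


section \<open>The represented proof graph\<close>

abbreviation "G \<equiv> graph_of I"

lemma bc_edges_iff: "(Q, R, P) \<in> bc_edges G \<longleftrightarrow> inferVia R P \<in> I \<and> inferenceNeeds P R Q \<in> I"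
  by (simp add: graph_of_def)

lemma fac_edges_iff: "(Q, P) \<in> fac_edges G \<longleftrightarrow> factorVia P Q \<in> I"
  by (simp add: graph_of_def)

lemma nodes_iff: "P \<in> nodes G \<longleftrightarrow> true P \<in> I"
  by (simp add: graph_of_def)

lemma edges_eq: "edges G = back_graph I \<union> fac_edges G"
  by (auto simp: edges_def bc_edges_iff back_graph_def)

lemma back_graph_nodes: "(Q, P) \<in> back_graph I \<Longrightarrow> Q \<in> nodes G \<and> P \<in> nodes G \<and> infer P \<in> I"
proof -
  assume "(Q, P) \<in> back_graph I"
  then obtain R where R: "inferVia R P \<in> I" "inferenceNeeds P R Q \<in> I"
    by (auto simp: back_graph_def)
  then show ?thesis
    using supp[OF R(1)] true_step true_iff_derived nodes_iff by auto
qed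

lemma edges_nodes: "(Q, P) \<in> edges G \<Longrightarrow> Q \<in> nodes G \<and> P \<in> nodes G"
  using back_graph_nodes factorVia_fai fai_true nodes_iff by (auto simp: edges_eq fac_edges_iff)

section \<open>Finiteness and acyclicity of the graph\<close>

definition chain_rel :: "(gterm \<times> gterm) set" where
  "chain_rel = {(Q, P). \<exists>a\<in>axioms A. \<exists>Qs. back_chain a P Qs \<and> Q \<in> set Qs}"

lemma wf_chain_rel: "wf chain_rel"
  using inst by (simp add: abduction_instance_def acyclic_axioms_def chain_rel_def)

lemma back_graph_subset: "back_graph I \<subseteq> chain_rel"
proof (clarsimp simp: back_graph_def)
  fix Q P R assume "inferenceNeeds P R Q \<in> I"
  from supp[OF this] show "(Q, P) \<in> chain_rel"
    by (auto simp: chain_rel_def)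
qed

lemma finite_nodes: "finite (nodes G)"
proof (rule finite_subset)
  show "nodes G \<subseteq> (\<Union>g\<in>goals A. {P. (P, g) \<in> chain_rel\<^sup>*})"
    using rtrancl_mono[OF back_graph_subset]
    by (fastforce simp: nodes_iff true_iff_derived derived_def)
  have fin: "finite (axioms A)" "finite (goals A)"
    using inst by (auto simp: abduction_instance_def goals_def)
  have "finite {Q. (Q, P) \<in> chain_rel}" for P
    using finite_back_chain_predecessors[OF fin(1), of P] unfolding chain_rel_def by simp
  then show "finite (\<Union>g\<in>goals A. {P. (P, g) \<in> chain_rel\<^sup>*})"
    using fin(2) finite_wf_predecessors[OF wf_chain_rel] by blast
qed

lemma finite_edges: "finite (edges G)"
proof (rule finite_subset)
  show "edges G \<subseteq> nodes G \<times> nodes G"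
    using edges_nodes by auto
qed (use finite_nodes in auto)

lemma finite_fac_edges: "finite (fac_edges G)"
  using finite_edges by (simp add: edges_eq)

lemma finite_bc_edges: "finite (bc_edges G)"
proof (rule finite_subset)
  show "bc_edges G \<subseteq> (\<Union>(Q, P)\<in>edges G. (\<lambda>a. (Q, Sym (ident a), P)) ` axioms A)"
  proof clarify
    fix Q R P assume e: "(Q, R, P) \<in> bc_edges G"
    then have "(Q, P) \<in> edges G"
      by (auto simp: edges_def)
    moreover obtain a where "a \<in> axioms A" "R = Sym (ident a)"
      using e inferVia_back_chain by (metis bc_edges_iff)
    ultimately show "(Q, R, P) \<in> (\<Union>(Q, P)\<in>edges G. (\<lambda>a. (Q, Sym (ident a), P)) ` axioms A)"
      by blast
  qed
  show "finite (\<Union>(Q, P)\<in>edges G. (\<lambda>a. (Q, Sym (ident a), P)) ` axioms A)"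
    using finite_edges inst by (auto simp: abduction_instance_def)
qed

text \<open>The atom that a cluster is factored into is neither inferred nor factored itself, so factoring
  edges start at nodes without incoming edges.\<close>

lemma fac_source_no_incoming:
  assumes "(Q, P) \<in> fac_edges G"
  shows "(Z, Q) \<notin> edges G"
proof
  assume "(Z, Q) \<in> edges G"
  then consider "infer Q \<in> I" | "factorVia Q Z \<in> I"
    by (auto simp: edges_eq fac_edges_iff dest: back_graph_nodes)
  then show False
  proof cases
    case 1
    then show False
      using assms factorVia_fai fai_true infer_fai_exclusive by (auto simp: fac_edges_iff)
  next
    case 2
    then show False
      using assms by (auto simp: fac_edges_iff factorVia_iff factorClusterAbove_iff)
  qed
qed

lemma acyclic_edges: "acyclic (edges G)"
proof (rule acyclicI, rule allI, rule notI)
  fix x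
  assume x: "(x, x) \<in> (edges G)\<^sup>+"
  \<comment> \<open>A factoring edge can only be the first edge of a path, since nothing enters its
    source. On a cycle something enters every node, which leaves back-chaining edges alone.\<close>
  have "(y, z) \<in> (back_graph I)\<^sup>+ \<or> (\<exists>P. (y, P) \<in> fac_edges G)" if "(y, z) \<in> (edges G)\<^sup>+" for y z
    using that
  proof (induction rule: converse_trancl_induct)
    case (base y)
    then show ?case by (auto simp: edges_eq)
  next
    case (step y w)
    then show ?case
      using fac_source_no_incoming
      by (auto simp: edges_eq intro: trancl_into_trancl2)
  qed
  moreover have "(x, x) \<notin> (back_graph I)\<^sup>+"
    using wf_acyclic[OF wf_subset[OF wf_chain_rel back_graph_subset]] by (auto simp: acyclic_def)
  moreover obtain z where "(z, x) \<in> edges G"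
    using x by (auto elim: tranclE)
  ultimately show False
    using x fac_source_no_incoming by blast
qed

lemma single_justification_G: "single_justification G"
  unfolding single_justification_def
proof (intro conjI allI impI notI)
  fix P Q Q' a a' assume "(Q, a, P) \<in> bc_edges G" "(Q', a', P) \<in> bc_edges G"
  then show "a = a'"
    using inferVia_unique by (auto simp: bc_edges_iff)
next
  fix P Q Q' assume "(Q, P) \<in> fac_edges G" "(Q', P) \<in> fac_edges G"
  then show "Q = Q'"
    using factorVia_unique by (auto simp: fac_edges_iff)
next
  fix P Q Q' a assume "(Q, a, P) \<in> bc_edges G \<and> (Q', P) \<in> fac_edges G"
  then have "infer P \<in> I" "fai P \<in> I"
    using factorVia_fai inferVia_infer by (auto simp: bc_edges_iff fac_edges_iff)
  then show False
    using fai_true infer_fai_exclusive by blast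
qed

text \<open>A derivation with the maximal number of back-chaining edges of \<^term>\<open>G\<close> yields all of them:
  otherwise, one more back-chaining step would be possible.\<close>

lemma generates_nodes: "generates A (nodes G) {} (bc_edges G) {}"
proof -
  \<comment> \<open>The last clause puts the source of each recorded edge into \<open>N\<close>.
    Thus, once all edges into atoms of \<open>N\<close> are recorded, \<open>N\<close> contains
    every derived atom.\<close>
  define S where "S = (\<lambda>(N, Bc). generates A N {} Bc {} \<and> N \<subseteq> nodes G \<and> Bc \<subseteq> bc_edges G \<and>
    (\<forall>(Q, R, P)\<in>Bc. Q \<in> N))"
  have "S (goals A, {})"
    using true_goal by (auto simp: S_def nodes_iff intro: generates.start)
  moreover have "\<forall>y. S y \<longrightarrow> card (snd y) < Suc (card (bc_edges G))"
    using card_mono[OF finite_bc_edges] by (auto simp: S_def less_Suc_eq_le)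
  ultimately obtain x where "S x" "\<forall>y. S y \<longrightarrow> card (snd y) \<le> card (snd x)"
    using ex_has_greatest_nat[of S _ "\<lambda>y. card (snd y)"] by blast
  then obtain N Bc where S: "S (N, Bc)" and max: "\<And>N' Bc'. S (N', Bc') \<Longrightarrow> card Bc' \<le> card Bc"
    by (cases x) auto
  have closed: "(Q, R, P) \<in> Bc" if "P \<in> N" "(Q, R, P) \<in> bc_edges G" for P Q R
  proof -
    have e: "inferVia R P \<in> I" "inferenceNeeds P R Q \<in> I"
      using that(2) by (auto simp: bc_edges_iff)
    obtain a Qs where a: "a \<in> axioms A" "R = Sym (ident a)" "back_chain a P Qs"
      "\<And>Q. inferenceNeeds P R Q \<in> I \<longleftrightarrow> Q \<in> set Qs"
      using inferVia_back_chain[OF e(1)] by metis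
    let ?Bc = "Bc \<union> {(Q, Sym (ident a), P) | Q. Q \<in> set Qs}"
    have new: "?Bc \<subseteq> bc_edges G"
      using S a e by (auto simp: S_def bc_edges_iff)
    have "generates A (N \<union> set Qs) {} ?Bc {}"
      using S that(1) a by (auto simp: S_def intro: generates.chain)
    moreover have "set Qs \<subseteq> nodes G"
      using a e true_step by (auto simp: nodes_iff)
    ultimately have "S (N \<union> set Qs, ?Bc)"
      using S new by (auto simp: S_def)
    then have "card ?Bc \<le> card Bc"
      by (rule max)
    then have "Bc = ?Bc"
      using finite_subset[OF new finite_bc_edges] by (intro card_seteq) auto
    then show ?thesis
      using a e by blast
  qed
  have goals: "goals A \<subseteq> M" if "generates A M E B F" for M E B F
    using that by induction auto
  have "P \<in> N" if "P \<in> derived A I" for P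
    using that
  proof (induction rule: derived_induct)
    case (goal g)
    then show ?case using S goals unfolding S_def by blast
  next
    case (step P Q R)
    then have "(Q, R, P) \<in> Bc"
      by (intro closed) (auto simp: bc_edges_iff)
    then show ?case using S by (auto simp: S_def)
  qed
  then have N: "N = nodes G"
    using S by (auto simp: S_def nodes_iff true_iff_derived)
  have "P \<in> nodes G" if "(Q, R, P) \<in> bc_edges G" for P Q R
    using that edges_nodes by (auto simp: edges_def)
  then have "Bc = bc_edges G"
    using closed S unfolding N by (auto simp: S_def)
  then show ?thesis
    using S N by (auto simp: S_def)
qed

text \<open>With all atoms already generated, the factoring edges can be added in any order.
  Arguments of a cluster that differ are related by \<open>eq\<close>, so no sort name is
  unified.\<close>

lemma generates_factoring:
  assumes "finite F" "F \<subseteq> fac_edges G"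
  shows "\<exists>E. generates A (nodes G) E (bc_edges G) F"
  using assms
proof (induction F rule: finite_induct)
  case empty
  then show ?case using generates_nodes by blast
next
  case (insert e F)
  obtain Q P where e: "e = (Q, P)"
    by force
  obtain E where E: "generates A (nodes G) E (bc_edges G) F"
    using insert by auto
  have via: "factorVia P Q \<in> I"
    using insert e by (auto simp: fac_edges_iff)
  then have cl: "factorCluster P Q \<in> I"
    by (simp add: factorVia_iff)
  obtain p s t s' t' where PQ: "P = c_term p s' t'" "Q = c_term p s t"
    using supp[OF cl] by auto
  have eq: "eq s s' \<in> I" "eq t t' \<in> I" and less: "tless Q P"
    using cl unfolding PQ factorCluster_iff by auto
  have "generates A (nodes G) (E \<union> ({(s, s'), (t, t')} - Id)) (bc_edges G) (insert (Q, P) F)"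
  proof (rule generates.unify[OF E _ _ _ PQ(2,1) refl])
    show "Q \<in> nodes G" "P \<in> nodes G"
      using via factorVia_fai fai_true by (auto simp: nodes_iff)
    show "Q \<noteq> P"
      using less tless_asym by blast
    show "\<forall>(X, Y)\<in>{(s, s'), (t, t')} - Id. X \<notin> Sym ` sorts A \<and> Y \<notin> Sym ` sorts A"
      using eq eq_not_sort by blast
  qed
  then show ?case
    using e by blast
qed

lemma proof_graph_G: "\<exists>H\<in>hypotheses A. proof_graph A H G"
proof -
  obtain E where E: "generates A (nodes G) E (bc_edges G) (fac_edges G)"
    using generates_factoring[OF finite_fac_edges order_refl] by blast
  then have "proof_graph A (nodes G, E) G"
    using acyclic_edges single_justification_G by (simp add: proof_graph_def)
  moreover have "(nodes G, E) \<in> hypotheses A"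
    using E by (auto simp: hypotheses_def)
  ultimately show ?thesis ..
qed

lemma abduced_iff: "P \<in> abduced G \<longleftrightarrow> abduce P \<in> I"
proof
  assume P: "P \<in> abduced G"
  then have no: "(Q, P) \<notin> edges G" for Q
    by (auto simp: abduced_def)
  have "true P \<in> I"
    using P by (auto simp: abduced_def nodes_iff)
  moreover have "infer P \<notin> I"
  proof
    assume "infer P \<in> I"
    then obtain R where R: "inferVia R P \<in> I"
      using infer_inferVia_ex1 by blast
    obtain a Qs where a: "a \<in> axioms A" "back_chain a P Qs"
      "\<And>Q. inferenceNeeds P R Q \<in> I \<longleftrightarrow> Q \<in> set Qs"
      using inferVia_back_chain[OF R] by metis
    \<comment> \<open>An inferred atom has an incoming edge only because the axiom body is nonempty;
      otherwise it would look abduced in the graph.\<close>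
    have "batoms a \<noteq> []"
      using inst a(1) by (auto simp: abduction_instance_def)
    then have "hd Qs \<in> set Qs"
      using back_chain_length[OF a(2)] by (cases Qs) auto
    then show False
      using R a(3) no by (auto simp: edges_graph_of)
  qed
  ultimately show "abduce P \<in> I"
    using no infer_fai_exclusive by (auto simp: abduce_iff factor_iff edges_graph_of)
next
  assume "abduce P \<in> I"
  then have P: "fai P \<in> I" "factor P \<notin> I"
    by (auto simp: abduce_iff)
  then have "infer P \<notin> I" "true P \<in> I"
    using fai_true infer_fai_exclusive by auto
  then show "P \<in> abduced G"
    using P by (auto simp: abduced_def nodes_iff edges_graph_of factor_iff dest: inferVia_infer)
qed


section \<open>Costs of answer sets\<close>

text \<open>Costs are summed over a set of tuples, so equal tuples would be merged; injectivity of
  \<open>t\<close> keeps one tuple per element of \<open>X\<close>.\<close>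

lemma answer_cost_image:
  assumes "\<And>w l ts. (\<exists>b. Weak b w l ts \<in> prog \<and> body_sat I b) \<longleftrightarrow>
      (\<exists>x\<in>X. w = c x \<and> l = 1 \<and> ts = t x)"
    and "inj_on t X"
  shows "answer_cost prog I = (\<Sum>x\<in>X. c x)"
proof -
  have "{(w, l, ts). \<exists>b. Weak b w l ts \<in> prog \<and> body_sat I b} = (\<lambda>x. (c x, 1, t x)) ` X"
    unfolding assms(1) by auto
  moreover have "inj_on (\<lambda>x. (c x, 1 :: nat, t x)) X"
    using assms(2) by (auto simp: inj_on_def)
  ultimately show ?thesis
    by (simp add: answer_cost_def sum.reindex)
qed

lemma no_weak_base: "Weak b w l ts \<notin> P_BwdA A \<union> P_bodies A"
  by (auto simp: P_BwdA_def P_bpt_def P_gp_def P_eq_def P_c_def P_bodies_def)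

section \<open>Cardinality minimality\<close>

lemma CARD_cost:
  assumes "prog = P_BwdA A \<union> P_CARD"
  shows "answer_cost prog I = int (CARD_obj G)"
proof -
  have "answer_cost prog I = (\<Sum>x\<in>abduced G. 1)"
  proof (rule answer_cost_image[where t = "\<lambda>x. [x]"])
    fix w l ts
    show "(\<exists>b. Weak b w l ts \<in> prog \<and> body_sat I b) \<longleftrightarrow>
        (\<exists>x\<in>abduced G. w = 1 \<and> l = 1 \<and> ts = [x])"
      using no_weak_base unfolding assms P_CARD_def
      by (auto simp: body_sat_def abduced_iff)
  qed (simp add: inj_on_def)
  then show ?thesis
    by (simp add: CARD_obj_def)
qed

section \<open>Coherence\<close>

lemma reach_iff:
  assumes "P_COH \<subseteq> prog"
  shows "reach Q g \<in> I \<longleftrightarrow> g \<in> goals A \<and> (Q, g) \<in> (edges G)\<^sup>*"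
proof
  assume "g \<in> goals A \<and> (Q, g) \<in> (edges G)\<^sup>*"
  then have g: "g \<in> goals A" and "(Q, g) \<in> (edges G)\<^sup>*"
    by auto
  note head = subprogram_head[OF assms]
  show "reach Q g \<in> I"
    using \<open>(Q, g) \<in> (edges G)\<^sup>*\<close>
  proof (induction rule: converse_rtrancl_induct)
    case base
    show ?case
      by (rule head[of _ "[pos (goal g)]"]) (use g in \<open>auto simp: P_COH_def body_sat_def goal_iff\<close>)
  next
    case (step Q P)
    from step(1) consider R where "inferVia R P \<in> I" "inferenceNeeds P R Q \<in> I" | "factorVia P Q \<in> I"
      by (auto simp: edges_graph_of)
    then show ?case
    proof cases
      case 1
      show ?thesis
        by (rule head[of _ "[pos (reach P g), pos (inferVia R P), pos (inferenceNeeds P R Q)]"])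
          (use 1 step.IH in \<open>auto simp: P_COH_def body_sat_def\<close>)
    next
      case 2
      show ?thesis
        by (rule head[of _ "[pos (reach P g), pos (factorVia P Q)]"])
          (use 2 step.IH in \<open>auto simp: P_COH_def body_sat_def\<close>)
    qed
  qed
qed (use supp in force)

lemma reachFromBoth_iff:
  assumes "P_COH \<subseteq> prog" "g \<in> goals A" "h \<in> goals A" "tless g h"
  shows "reachFromBoth g h \<in> I \<longleftrightarrow>
    (\<exists>n. n \<in> nodes G \<and> (n, g) \<in> (edges G)\<^sup>* \<and> (n, h) \<in> (edges G)\<^sup>*)"
    (is "_ \<longleftrightarrow> ?r")
proof
  assume "reachFromBoth g h \<in> I"
  then obtain n where n: "reach n g \<in> I" "reach n h \<in> I"
    using supp by force
  then have e: "(n, g) \<in> (edges G)\<^sup>*" "(n, h) \<in> (edges G)\<^sup>*"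
    using reach_iff assms by auto
  \<comment> \<open>This settles the path of length zero; any longer path starts with an edge, whose
    ends are nodes.\<close>
  have "g \<in> nodes G"
    using assms(2) true_goal nodes_iff by blast
  then have "n \<in> nodes G"
    using e(1) edges_nodes by (auto elim: converse_rtranclE)
  then show ?r
    using e by blast
next
  assume ?r
  then obtain n where n: "reach n g \<in> I" "reach n h \<in> I"
    using reach_iff assms by auto
  have "rule (reachFromBoth g h)
      [pos (goal g), pos (goal h), cmp (tless g h), pos (reach n g), pos (reach n h)] \<in> P_COH"
    unfolding P_COH_def by blast
  from subprogram_head[OF assms(1) this] show "reachFromBoth g h \<in> I"
    using n assms by (simp add: body_sat_def goal_iff)
qed

lemma COH_cost:
  assumes prog: "prog = P_BwdA A \<union> P_COH" and lt: "strict_linear_order_on (goals A) lt"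
  shows "answer_cost prog I = int (COH_obj A lt G)"
proof -
  define C where
    "C a b = (\<nexists>n. n \<in> nodes G \<and> (n, a) \<in> (edges G)\<^sup>* \<and> (n, b) \<in> (edges G)\<^sup>*)" for a b
  have C: "C a b \<Longrightarrow> C b a" for a b
    unfolding C_def by blast
  have sub: "P_COH \<subseteq> prog"
    using prog by blast
  let ?X = "{(a, b). a \<in> goals A \<and> b \<in> goals A \<and> tless a b \<and> C a b}"
  have "answer_cost prog I = (\<Sum>x\<in>?X. 1)"
  proof (rule answer_cost_image[where t = "\<lambda>(a, b). [a, b]"])
    fix w l ts
    have "(\<exists>b. Weak b w l ts \<in> prog \<and> body_sat I b) \<longleftrightarrow>
        (\<exists>a b. a \<in> goals A \<and> b \<in> goals A \<and> tless a b \<and> reachFromBoth a b \<notin> I \<and>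
           w = 1 \<and> l = 1 \<and> ts = [a, b])"
      using no_weak_base unfolding prog P_COH_def
      by (auto simp: body_sat_def goal_iff)
    also have "\<dots> \<longleftrightarrow> (\<exists>x\<in>?X. w = 1 \<and> l = 1 \<and> ts = (case x of (a, b) \<Rightarrow> [a, b]))"
      using reachFromBoth_iff[OF sub] by (auto simp: C_def)
    finally show "(\<exists>b. Weak b w l ts \<in> prog \<and> body_sat I b) \<longleftrightarrow>
        (\<exists>x\<in>?X. w = 1 \<and> l = 1 \<and> ts = (case x of (a, b) \<Rightarrow> [a, b]))" .
  qed (auto simp: inj_on_def)
  moreover have "card ?X = card {(a, b). a \<in> goals A \<and> b \<in> goals A \<and> (a, b) \<in> lt \<and> C a b}"
  proof (rule trans[OF card_oriented_pairs card_oriented_pairs[symmetric]])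
    show "\<not> tless b a" if "tless a b" for a b
      using that tless_asym by blast
    show "tless a b \<or> tless b a" if "a \<noteq> b" for a b
      using that tless_total by blast
    show "(b, a) \<notin> lt" if "(a, b) \<in> lt" for a b
      using that lt by (auto simp: strict_linear_order_on_def irrefl_def dest: transD)
    show "(a, b) \<in> lt \<or> (b, a) \<in> lt" if "a \<in> goals A" "b \<in> goals A" "a \<noteq> b" for a b
      using that lt by (auto simp: strict_linear_order_on_def total_on_def)
  qed (use C in auto)
  ultimately show ?thesis
    by (simp add: COH_obj_def C_def)
qed

section \<open>Weighted abduction\<close>

abbreviation "wcost \<equiv> wa_cost A ic100 uniform_weight round_cost G"

lemma wf_converse_edges: "wf ((edges G)\<inverse>)"
  using finite_acyclic_wf_converse finite_edges acyclic_edges by blast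

lemma wcost_iff:
  "v \<in> wcost Q \<longleftrightarrow> Q \<in> nodes G \<and>
     (Q \<in> goals A \<and> v = 100 \<or>
      (\<exists>P a. a \<in> axioms A \<and> (Q, Sym (ident a), P) \<in> bc_edges G \<and> wcost P \<noteq> {} \<and>
         v = round_cost (Min (wcost P) * (1.2 / real (length (batoms a))))) \<or>
      (\<exists>P. (Q, P) \<in> fac_edges G \<and> wcost P \<noteq> {} \<and> v = Min (wcost P)))"
proof -
  have index: "\<exists>Qs i. back_chain a P Qs \<and> i < length Qs \<and> Q = Qs ! i"
    if a: "a \<in> axioms A" "(Q, Sym (ident a), P) \<in> bc_edges G" for a P
  proof -
    have e: "inferVia (Sym (ident a)) P \<in> I" "inferenceNeeds P (Sym (ident a)) Q \<in> I"
      using a(2) by (auto simp: bc_edges_iff)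
    from supp[OF e(2)] obtain a' Qs where a': "a' \<in> axioms A" "ident a = ident a'"
      "back_chain a' P Qs" "Q \<in> set Qs"
      by auto
    then have "a' = a"
      using a(1) ident_inj by simp
    then show ?thesis
      using a' by (auto simp: in_set_conv_nth)
  qed
  have node: "P \<in> nodes G" if "(Q, R, P) \<in> bc_edges G \<or> (Q, P) \<in> fac_edges G" for R P
    using that edges_nodes by (auto simp: edges_def)
  have "v \<in> wcost Q \<longleftrightarrow> v \<in> wa_step A ic100 uniform_weight round_cost G wcost Q"
    using wa_cost_step[OF wf_converse_edges] by metis
  also have "\<dots> \<longleftrightarrow> Q \<in> nodes G \<and>
     (Q \<in> goals A \<and> v = 100 \<or>
      (\<exists>P a Qs i. P \<in> nodes G \<and> wcost P \<noteq> {} \<and> a \<in> axioms A \<and> back_chain a P Qs \<and>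
         i < length Qs \<and> Q = Qs ! i \<and> (Q, Sym (ident a), P) \<in> bc_edges G \<and>
         v = round_cost (Min (wcost P) * (1.2 / real (length (batoms a))))) \<or>
      (\<exists>P. P \<in> nodes G \<and> (Q, P) \<in> fac_edges G \<and> wcost P \<noteq> {} \<and> v = Min (wcost P)))"
    unfolding wa_step_mem uniform_weight_def ic100_def by blast
  also have "\<dots> \<longleftrightarrow> Q \<in> nodes G \<and>
     (Q \<in> goals A \<and> v = 100 \<or>
      (\<exists>P a. a \<in> axioms A \<and> (Q, Sym (ident a), P) \<in> bc_edges G \<and> wcost P \<noteq> {} \<and>
         v = round_cost (Min (wcost P) * (1.2 / real (length (batoms a))))) \<or>
      (\<exists>P. (Q, P) \<in> fac_edges G \<and> wcost P \<noteq> {} \<and> v = Min (wcost P)))"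
    using index node by blast
  finally show ?thesis .
qed

lemma wcost_goal: "g \<in> goals A \<Longrightarrow> 100 \<in> wcost g"
  unfolding wcost_iff[of _ g] nodes_iff using true_goal by blast

lemma wcost_chain:
  assumes "a \<in> axioms A" "(Q, Sym (ident a), P) \<in> bc_edges G" "wcost P \<noteq> {}"
  shows "round_cost (Min (wcost P) * (1.2 / real (length (batoms a)))) \<in> wcost Q"
proof -
  have "Q \<in> nodes G"
    using assms(2) edges_nodes by (auto simp: edges_def)
  then show ?thesis
    unfolding wcost_iff[of _ Q] using assms by blast
qed

lemma wcost_factor:
  assumes "(Q, P) \<in> fac_edges G" "wcost P \<noteq> {}"
  shows "Min (wcost P) \<in> wcost Q"
proof -
  have "Q \<in> nodes G"
    using assms(1) edges_nodes by (auto simp: edges_def)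
  then show ?thesis
    unfolding wcost_iff[of _ Q] using assms by blast
qed

lemma finite_wcost: "finite (wcost Q)"
proof (rule finite_subset)
  show "wcost Q \<subseteq> {100} \<union>
      (\<lambda>(P, a). round_cost (Min (wcost P) * (1.2 / real (length (batoms a))))) ` (nodes G \<times> axioms A) \<union>
      (\<lambda>P. Min (wcost P)) ` nodes G" (is "_ \<subseteq> ?S")
  proof
    fix v assume "v \<in> wcost Q"
    then consider "v = 100"
      | P a where "a \<in> axioms A" "(Q, Sym (ident a), P) \<in> bc_edges G"
          "v = round_cost (Min (wcost P) * (1.2 / real (length (batoms a))))"
      | P where "(Q, P) \<in> fac_edges G" "v = Min (wcost P)"
      using wcost_iff[of v Q] by blast
    then show "v \<in> ?S"
    proof cases
      case 2
      then have "P \<in> nodes G"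
        using edges_nodes by (auto simp: edges_def)
      then show ?thesis using 2 by force
    next
      case 3
      then have "P \<in> nodes G"
        using edges_nodes by (auto simp: edges_def)
      then show ?thesis using 3 by force
    qed simp
  qed
  have "finite (axioms A)"
    using inst by (simp add: abduction_instance_def)
  then show "finite ({100} \<union>
      (\<lambda>(P, a). round_cost (Min (wcost P) * (1.2 / real (length (batoms a))))) ` (nodes G \<times> axioms A) \<union>
      (\<lambda>P. Min (wcost P)) ` nodes G)"
    using finite_nodes by simp
qed

lemma pcost_goal:
  assumes "P_WA \<subseteq> prog" "g \<in> goals A"
  shows "pcost g (Num 100) \<in> I"
proof -
  have "rule (pcost g (Num 100)) [pos (goal g)] \<in> P_WA"
    unfolding P_WA_def by blast
  from subprogram_head[OF assms(1) this] show ?thesis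
    using assms(2) by (simp add: body_sat_def goal_iff)
qed

lemma pcost_factor:
  assumes "P_WA \<subseteq> prog" "factorVia P Q \<in> I" "pcost P C \<in> I"
  shows "pcost Q C \<in> I"
proof -
  have "rule (pcost Q C) [pos (factorVia P Q), pos (pcost P C)] \<in> P_WA"
    unfolding P_WA_def by blast
  from subprogram_head[OF assms(1) this] show ?thesis
    using assms(2,3) by (simp add: body_sat_def)
qed

lemma axiom_bodies: "a \<in> axioms A \<Longrightarrow> 0 < length (batoms a)"
  using inst by (auto simp: abduction_instance_def)

lemma pcost_chain:
  assumes WA: "P_WA \<subseteq> prog" "P_bodies A \<subseteq> prog"
    and a: "a \<in> axioms A" and e: "(Q, Sym (ident a), P) \<in> bc_edges G"
    and k: "pcost P (Num k) \<in> I"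
  shows "pcost Q (Num (max (asp_div (asp_div (k * 6) 5) (int (length (batoms a)))) 1)) \<in> I"
proof -
  define R where "R = Sym (ident a)"
  define n where "n = int (length (batoms a))"
  define x where "x = asp_div (asp_div (k * 6) 5) n"
  \<comment> \<open>Only instances with a nonzero divisor belong to the grounding of this
    rule.\<close>
  have "n \<noteq> 0"
    using axiom_bodies[OF a] by (simp add: n_def)
  then have r: "rule (pcost Q (Num (max x 1)))
      [pos (inferVia R P), pos (inferenceNeeds P R Q),
       MaxEq (Num (max x 1)) {(Num (asp_div (asp_div (k * 6) 5) n), []), (Num 1, [])},
       pos (pcost P (Num k)), pos (numberOfBodies R (Num n))] \<in> P_WA"
    unfolding P_WA_def by blast
  have "fact (numberOfBodies R (Num n)) \<in> P_bodies A"
    using a unfolding P_bodies_def R_def n_def by blast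
  from subprogram_head[OF WA(2) this] have "numberOfBodies R (Num n) \<in> I"
    by (simp add: body_sat_def)
  then show ?thesis
    using subprogram_head[OF WA(1) r] e k
    by (auto simp: bc_edges_iff body_sat_def maxEq_Num_sat x_def n_def R_def simp del: blit_sat.simps(3))
qed

lemma cost_rule:
  assumes "P_WA \<subseteq> prog" "abduce P \<in> I" "pcost P C \<in> I" "\<And>D. pcost P D \<in> I \<Longrightarrow> tle C D"
  shows "cost P C \<in> I"
proof -
  have "rule (cost P C) [pos (abduce P), MinEq C {(Ic, [Pos (pcost P Ic)]) | Ic. True}] \<in> P_WA"
    unfolding P_WA_def by blast
  from subprogram_head[OF assms(1) this] show ?thesis
    using assms(2-) by (auto simp: body_sat_def agg_terms_def lits_sat_def)
qed

text \<open>The program propagates all costs, in particular the minima that \<open>wcost\<close>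
  propagates. Induction runs from the goals along the converse of the edges; that values are
  integers of at least 1 is carried along to apply \<open>round_cost_asp_div\<close>.\<close>

lemma wcost_pcost:
  assumes WA: "P_WA \<subseteq> prog" "P_bodies A \<subseteq> prog" and "v \<in> wcost Q"
  shows "\<exists>k\<ge>1. v = of_int k \<and> pcost Q (Num k) \<in> I"
  using assms(3)
proof (induction Q arbitrary: v rule: wf_induct_rule[OF wf_converse_edges])
  case (1 Q)
  have IH: "\<exists>k\<ge>1. Min (wcost P) = of_int k \<and> pcost P (Num k) \<in> I"
    if "(Q, P) \<in> edges G" "wcost P \<noteq> {}" for P
    using 1(1)[of P "Min (wcost P)"] that finite_wcost by auto
  from 1(2) consider "Q \<in> goals A" "v = 100"
    | P a where "a \<in> axioms A" "(Q, Sym (ident a), P) \<in> bc_edges G" "wcost P \<noteq> {}"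
        "v = round_cost (Min (wcost P) * (1.2 / real (length (batoms a))))"
    | P where "(Q, P) \<in> fac_edges G" "wcost P \<noteq> {}" "v = Min (wcost P)"
    using wcost_iff[of v Q] by blast
  then show ?case
  proof cases
    case 1
    then show ?thesis
      using pcost_goal[OF WA(1), of Q] by (intro exI[of _ 100]) auto
  next
    case 2
    then have "(Q, P) \<in> edges G"
      by (auto simp: edges_def)
    then obtain k where k: "k \<ge> 1" "Min (wcost P) = of_int k" "pcost P (Num k) \<in> I"
      using IH 2 by blast
    then have "v = of_int (max (asp_div (asp_div (k * 6) 5) (int (length (batoms a)))) 1)"
      using 2 axiom_bodies round_cost_asp_div by simp
    then show ?thesis
      using pcost_chain[OF WA 2(1,2) k(3)] by (intro exI conjI) auto
  next
    case 3
    then have "(Q, P) \<in> edges G"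
      by (auto simp: edges_def)
    then obtain k where "k \<ge> 1" "Min (wcost P) = of_int k" "pcost P (Num k) \<in> I"
      using IH 3(2) by blast
    moreover have "factorVia P Q \<in> I"
      using 3(1) by (simp add: fac_edges_iff)
    ultimately show ?thesis
      using 3(3) pcost_factor[OF WA(1)] by blast
  qed
qed

text \<open>The minimum of \<^term>\<open>wcost P\<close> need not be the value propagated by the program, but monotonicity
  of the rounding turns a bound at \<^term>\<open>P\<close> into one at each predecessor.\<close>

lemma pcost_lower_bound:
  assumes "pcost Q C \<in> I"
  shows "\<exists>k\<ge>1. C = Num k \<and> wcost Q \<noteq> {} \<and> Min (wcost Q) \<le> of_int k"
proof -
  define bound where "bound Q C \<longleftrightarrow>
    (\<exists>k\<ge>1. C = Num k \<and> wcost Q \<noteq> {} \<and> Min (wcost Q) \<le> of_int k)" for Q C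
  have boundI: "bound Q (Num k)" if "v \<in> wcost Q" "k \<ge> 1" "v \<le> of_int k" for Q v k
    using that Min_le[OF finite_wcost that(1)] by (auto simp: bound_def)
  \<comment> \<open>Induction over the answer set ranges over all atoms, so the claim is made
    vacuous for those other than \<open>pcost\<close>.\<close>
  define \<Phi> where "\<Phi> x = (\<forall>Q C. x = pcost Q C \<longrightarrow> bound Q C)" for x
  have "\<Phi> x" if "x \<in> I" for x
    using ans that
  proof (induction x rule: answer_set_induct)
    case (head a b)
    show ?case
      unfolding \<Phi>_def
    proof (intro allI impI)
      fix Q C assume "a = pcost Q C"
      then have "Rule (Head (pcost Q C)) b \<in> P_all A"
        using head(1) sub by blast
      then consider "b = [pos (goal Q)]" "C = Num 100"
        | P R k N where "b = [pos (inferVia R P), pos (inferenceNeeds P R Q),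
           MaxEq C {(Num (asp_div (asp_div (k * 6) 5) N), []), (Num 1, [])},
           pos (pcost P (Num k)), pos (numberOfBodies R (Num N))]"
        | P where "b = [pos (factorVia P Q), pos (pcost P C)]"
        using P_all_pcost by blast
      then show "bound Q C"
      proof cases
        case 1
        then have "Q \<in> goals A"
          using head(2) by (simp add: body_sat_def goal_iff)
        then show ?thesis
          using 1 boundI[OF wcost_goal] by auto
      next
        case 2
        then have I: "inferVia R P \<in> I" "inferenceNeeds P R Q \<in> I" "numberOfBodies R (Num N) \<in> I"
          and C: "C = Num (max (asp_div (asp_div (k * 6) 5) N) 1)"
          using head(2) by (simp_all add: body_sat_def maxEq_Num_sat del: blit_sat.simps(3))
        obtain a where a: "a \<in> axioms A" "R = Sym (ident a)" "N = int (length (batoms a))"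
          using supp[OF I(3)] by auto
        have "\<Phi> (pcost P (Num k))"
          using head(3) 2 by (auto simp: body_sat_def)
        then have k: "k \<ge> 1" "wcost P \<noteq> {}" "Min (wcost P) \<le> of_int k"
          by (auto simp: \<Phi>_def bound_def)
        let ?v = "round_cost (Min (wcost P) * (1.2 / real (length (batoms a))))"
        have "?v \<in> wcost Q"
          using I a(1,2) k(2) by (intro wcost_chain) (simp_all add: bc_edges_iff)
        moreover have "?v \<le> round_cost (of_int k * (1.2 / real (length (batoms a))))"
          using k(3) by (intro round_cost_mono mult_right_mono) auto
        ultimately show ?thesis
          using boundI C a round_cost_asp_div[OF k(1) axiom_bodies[OF a(1)]] by auto
      next
        case 3
        then have I: "factorVia P Q \<in> I"
          using head(2) by (auto simp: body_sat_def)
        have "\<Phi> (pcost P C)"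
          using head(3) 3 by (auto simp: body_sat_def)
        then obtain k where k: "k \<ge> 1" "C = Num k" "wcost P \<noteq> {}" "Min (wcost P) \<le> of_int k"
          by (auto simp: \<Phi>_def bound_def)
        have "Min (wcost P) \<in> wcost Q"
          using I k(3) by (intro wcost_factor) (simp_all add: fac_edges_iff)
        then show ?thesis
          using boundI k by auto
      qed
    qed
  next
    case (choice lo es up b a ls)
    then show ?case
      using P_all_choice[OF subsetD[OF sub choice(1)] choice(3)] by (auto simp: \<Phi>_def)
  qed
  from this[OF assms] show ?thesis
    by (simp add: \<Phi>_def bound_def)
qed

text \<open>Every node descends from a goal by back-chaining, and each such step passes on a cost.
  This makes the minima in the objective function minima of nonempty sets.\<close>

lemma wcost_nonempty: "P \<in> nodes G \<Longrightarrow> wcost P \<noteq> {}"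
proof -
  assume "P \<in> nodes G"
  then have "P \<in> derived A I"
    by (simp add: nodes_iff true_iff_derived)
  then show ?thesis
  proof (induction rule: derived_induct)
    case (goal g)
    then show ?case using wcost_goal by blast
  next
    case (step P Q R)
    obtain a where a: "a \<in> axioms A" "R = Sym (ident a)"
      using inferVia_back_chain[OF \<open>inferVia R P \<in> I\<close>] by metis
    have "round_cost (Min (wcost P) * (1.2 / real (length (batoms a)))) \<in> wcost Q"
      using step a by (intro wcost_chain) (simp_all add: bc_edges_iff)
    then show ?case by blast
  qed
qed

text \<open>\<open>Min (wcost P)\<close> is itself a \<open>pcost\<close> value and bounds all
  others from below, so it is what the aggregate selects; antisymmetry on integers excludes any
  other value.\<close>

lemma cost_iff:
  assumes WA: "P_WA \<subseteq> prog" "P_bodies A \<subseteq> prog"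
  shows "cost P (Num k) \<in> I \<longleftrightarrow> P \<in> abduced G \<and> Min (wcost P) = of_int k"
proof -
  have least: "\<exists>m. Min (wcost P) = of_int m \<and> pcost P (Num m) \<in> I \<and>
      (\<forall>D. pcost P D \<in> I \<longrightarrow> tle (Num m) D)" if "P \<in> abduced G"
  proof -
    have "wcost P \<noteq> {}"
      using wcost_nonempty that by (auto simp: abduced_def)
    then have "Min (wcost P) \<in> wcost P"
      using finite_wcost by simp
    then obtain m where m: "Min (wcost P) = of_int m" "pcost P (Num m) \<in> I"
      using wcost_pcost[OF WA] by blast
    moreover have "tle (Num m) D" if "pcost P D \<in> I" for D
      using pcost_lower_bound[OF that] m(1) by (auto simp: tle_def)
    ultimately show ?thesis by blast
  qed
  show ?thesis
  proof
    assume "cost P (Num k) \<in> I"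
    from supp[OF this] have k: "abduce P \<in> I" "pcost P (Num k) \<in> I"
      "\<And>D. pcost P D \<in> I \<Longrightarrow> tle (Num k) D"
      by auto
    then obtain m where m: "Min (wcost P) = of_int m" "pcost P (Num m) \<in> I" "tle (Num m) (Num k)"
      using least abduced_iff by blast
    then have "m = k"
      using k(3)[OF m(2)] by (auto simp: tle_def)
    then show "P \<in> abduced G \<and> Min (wcost P) = of_int k"
      using k(1) m(1) abduced_iff by blast
  next
    assume "P \<in> abduced G \<and> Min (wcost P) = of_int k"
    then show "cost P (Num k) \<in> I"
      using least abduced_iff cost_rule[OF WA(1)] by (metis of_int_eq_iff)
  qed
qed

lemma WA_cost:
  assumes prog: "prog = P_BwdA A \<union> P_bodies A \<union> P_WA"
  shows "of_int (answer_cost prog I) = WA_obj A ic100 uniform_weight round_cost G"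
proof -
  have WA: "P_WA \<subseteq> prog" "P_bodies A \<subseteq> prog"
    using prog by auto
  \<comment> \<open>Weights of weak constraints are integers. The floor only changes the type, as
    the minimum of an abduced atom is an integer already.\<close>
  define c where "c P = \<lfloor>Min (wcost P)\<rfloor>" for P
  have c: "Min (wcost P) = of_int (c P)" if "P \<in> abduced G" for P
  proof -
    have "Min (wcost P) \<in> wcost P"
      using wcost_nonempty that finite_wcost by (auto simp: abduced_def)
    then obtain m :: int where "Min (wcost P) = of_int m"
      using wcost_pcost[OF WA] by blast
    then show ?thesis
      by (simp add: c_def)
  qed
  have "answer_cost prog I = (\<Sum>P\<in>abduced G. c P)"
  proof (rule answer_cost_image[where t = "\<lambda>P. [P]"])
    fix w l ts
    have "(\<exists>b. Weak b w l ts \<in> prog \<and> body_sat I b) \<longleftrightarrow>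
        (\<exists>P. cost P (Num w) \<in> I \<and> l = 1 \<and> ts = [P])"
      using no_weak_base unfolding prog P_WA_def by (auto simp: body_sat_def)
    also have "\<dots> \<longleftrightarrow> (\<exists>P\<in>abduced G. w = c P \<and> l = 1 \<and> ts = [P])"
      using c by (auto simp: cost_iff[OF WA] c_def)
    finally show "(\<exists>b. Weak b w l ts \<in> prog \<and> body_sat I b) \<longleftrightarrow>
        (\<exists>P\<in>abduced G. w = c P \<and> l = 1 \<and> ts = [P])" .
  qed (simp add: inj_on_def)
  then show ?thesis
    using c by (simp add: WA_obj_def)
qed

end

theorem proposition5:
  fixes A :: abduction and lt :: "(gterm \<times> gterm) set" and I :: "patom set"
  assumes "abduction_instance A"
    and "strict_linear_order_on (goals A) lt"
  shows
    "(answer_set (P_BwdA A \<union> P_CARD) I \<longrightarrow>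
        (\<exists>H\<in>hypotheses A. proof_graph A H (graph_of I)) \<and>
        answer_cost (P_BwdA A \<union> P_CARD) I = int (CARD_obj (graph_of I))) \<and>
     (answer_set (P_BwdA A \<union> P_COH) I \<longrightarrow>
        (\<exists>H\<in>hypotheses A. proof_graph A H (graph_of I)) \<and>
        answer_cost (P_BwdA A \<union> P_COH) I = int (COH_obj A lt (graph_of I))) \<and>
     (answer_set (P_BwdA A \<union> P_bodies A \<union> P_WA) I \<longrightarrow>
        (\<exists>H\<in>hypotheses A. proof_graph A H (graph_of I)) \<and>
        of_int (answer_cost (P_BwdA A \<union> P_bodies A \<union> P_WA) I) =
          WA_obj A ic100 uniform_weight round_cost (graph_of I))"
proof (intro conjI impI)
  assume "answer_set (P_BwdA A \<union> P_CARD) I"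
  then interpret bwd_answer_set A "P_BwdA A \<union> P_CARD" I
    using assms(1) by unfold_locales (auto simp: P_all_def)
  show "\<exists>H\<in>hypotheses A. proof_graph A H (graph_of I)"
    by (rule proof_graph_G)
  show "answer_cost (P_BwdA A \<union> P_CARD) I = int (CARD_obj (graph_of I))"
    by (rule CARD_cost) simp
next
  assume "answer_set (P_BwdA A \<union> P_COH) I"
  then interpret bwd_answer_set A "P_BwdA A \<union> P_COH" I
    using assms(1) by unfold_locales (auto simp: P_all_def)
  show "\<exists>H\<in>hypotheses A. proof_graph A H (graph_of I)"
    by (rule proof_graph_G)
  show "answer_cost (P_BwdA A \<union> P_COH) I = int (COH_obj A lt (graph_of I))"
    by (rule COH_cost) (use assms(2) in simp_all)
next
  assume "answer_set (P_BwdA A \<union> P_bodies A \<union> P_WA) I"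
  then interpret bwd_answer_set A "P_BwdA A \<union> P_bodies A \<union> P_WA" I
    using assms(1) by unfold_locales (auto simp: P_all_def)
  show "\<exists>H\<in>hypotheses A. proof_graph A H (graph_of I)"
    by (rule proof_graph_G)
  show "of_int (answer_cost (P_BwdA A \<union> P_bodies A \<union> P_WA) I) =
      WA_obj A ic100 uniform_weight round_cost (graph_of I)"
    by (rule WA_cost) simp
qed

end
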